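(* Let $X^7$ be a $3$-Sasakian $7$-manifold, let $a_1,a_2,a_3\in\mathbb{R}$ and let $A=i(a_1\eta_1+a_2\eta_2+a_3\eta_3)$, a connection on the trivial complex line bundle $L_0$ on $X$. Let $t>0$ and $\varepsilon\in\{\pm1\}$. Then $A$ is a deformed $\mathrm{G}_2$-instanton with respect to $\psi_{t,\varepsilon}$ if and only if either $a_1=a_2=a_3=0$ (so $A$ is the trivial flat connection), or one of the following holds: (1) $t\in(0,1/\sqrt2)$, $\varepsilon=+1$ and $a_1^2+a_2^2+a_3^2=\frac14(1-2t^2)$ (so there is a $2$-sphere of solutions); (2) $t\in(0,1/\sqrt2)$, $\varepsilon=-1$ and either [$a_1^2+a_2^2=\frac14(1+2t^2)$ and $a_3=0$] or [$a_1^2+a_2^2=0$ and $a_3^2=\frac14(1-2t^2)$] (so the solutions consist of a circle and two points); (3) $t\ge1/\sqrt2$, $\varepsilon=-1$, $a_1^2+a_2^2=\frac14(1+2t^2)$ and $a_3=0$ (so there is a circle of solutions).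
   Context: Setting. A complete Riemannian $7$-manifold $(X^7,g^{ts})$ is $3$-Sasakian if it has three orthonormal Killing fields $\xi_1,\xi_2,\xi_3$ with $[\xi_i,\xi_j]=2\epsilon_{ijk}\xi_k$, each inducing a Sasakian structure; $X$ is then compact. The $\xi_i$ generate a locally free $\mathrm{SU}(2)$-action with leaf space a $4$-orbifold $Z$ and projection $\pi:X\to Z$; $Z$ has a metric $g_Z$, anti-self-dual and Einstein with scalar curvature normalized to $48$, for which $\pi$ is an orbifold Riemannian submersion. The Levi-Civita connection of $Z$ induces a connection $\eta=\eta_i\otimes T_i$ on $\pi$ (with $T_i$ a basis of $\mathfrak{su}(2)$, $[T_i,T_j]=2\epsilon_{ijk}T_k$, and $\eta_i$ $1$-forms on $X$), with horizontal space $H=\ker\eta$ and curvature $d\eta+\frac12[\eta\wedge\eta]=-2\omega_i\otimes T_i$, where $\omega_1,\omega_2,\omega_3$ is an orthogonal basis of $\Lambda^2_+H$ with $|\omega_i|=\sqrt2$. Thus $d\eta_i=-2\omega_i-2\eta_j\wedge\eta_k$ for $(i,j,k)$ cyclic and $\omega_i\wedge\omega_j=2\delta_{ij}\pi^*\mathrm{vol}_Z$. Repeated indices are summed; $\eta_{ij}=\eta_i\wedge\eta_j$. For $t>0$, $\varepsilon\in\{\pm1\}$ the $4$-form $\psi_{t,\varepsilon}=\pi^*\mathrm{vol}_Z-t^2(\varepsilon\eta_{23}\wedge\omega_1+\varepsilon\eta_{31}\wedge\omega_2+\eta_{12}\wedge\omega_3)$ is closed and is the dual $4$-form of the $\mathrm{G}_2$-structure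 $\varphi_{t,\varepsilon}=\varepsilon t^3\eta_1\wedge\eta_2\wedge\eta_3-t(\eta_1\wedge\omega_1+\eta_2\wedge\omega_2+\varepsilon\eta_3\wedge\omega_3)$. A unitary connection $A$ is a deformed $\mathrm{G}_2$-instanton with respect to $\psi$ if its curvature satisfies $\frac16F_A^3+F_A\wedge\psi=0$. On $L_0$, connections are written as $i\mathbb{R}$-valued $1$-forms (relative to the trivial flat connection), so $F_A=dA$. *)

theory Defs
  imports "HOL-Analysis.Analysis"
begin

section \<open>Smooth maps between Euclidean spaces\<close>

(* C^n on an open set S. *)
primrec Ck_on :: "nat \<Rightarrow> 'a::euclidean_space set \<Rightarrow> ('a \<Rightarrow> 'b::real_normed_vector) \<Rightarrow> bool" where
  "Ck_on 0 S f \<longleftrightarrow> continuous_on S f"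
| "Ck_on (Suc n) S f \<longleftrightarrow>
     f differentiable_on S \<and> (\<forall>v. Ck_on n S (\<lambda>x. frechet_derivative f (at x) v))"

definition smooth_on :: "'a::euclidean_space set \<Rightarrow> ('a \<Rightarrow> 'b::real_normed_vector) \<Rightarrow> bool" where
  "smooth_on S f \<longleftrightarrow> (\<forall>n. Ck_on n S f)"


section \<open>Smooth 7-manifolds\<close>

(* The manifold is the whole type 'a; it is Hausdorff and second countable if 'a is of class
   t2_space and second_countable_topology. A chart is a pair (domain, coordinate map). The coordinate map is
   only meaningful on its domain. *)
type_synonym 'a chart = "'a set \<times> ('a \<Rightarrow> real^7)"

definition chart_img :: "'a chart \<Rightarrow> (real^7) set" where
  "chart_img c = snd c ` fst c"

definition transition :: "'a chart \<Rightarrow> 'a chart \<Rightarrow> real^7 \<Rightarrow> real^7" where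
  "transition c d = snd d \<circ> inv_into (fst c) (snd c)"

definition overlap :: "'a chart \<Rightarrow> 'a chart \<Rightarrow> (real^7) set" where
  "overlap c d = snd c ` (fst c \<inter> fst d)"

(* Jacobian at x of the coordinate change from c to d. *)
definition jac :: "'a chart \<Rightarrow> 'a chart \<Rightarrow> real^7 \<Rightarrow> real^7 \<Rightarrow> real^7" where
  "jac c d x = frechet_derivative (transition c d) (at x)"

definition smooth_atlas :: "'a::topological_space chart set \<Rightarrow> bool" where
  "smooth_atlas \<A> \<longleftrightarrow>
     (\<Union>c\<in>\<A>. fst c) = UNIV \<and>
     (\<forall>c\<in>\<A>. open (fst c) \<and> open (chart_img c) \<and>
        homeomorphism (fst c) (chart_img c) (snd c) (inv_into (fst c) (snd c))) \<and>
     (\<forall>c\<in>\<A>. \<forall>d\<in>\<A>. smooth_on (overlap c d) (transition c d))"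


section \<open>Tensor fields\<close>

(* A tensor field is given by its coordinate expression in every chart of the atlas: the
   expression at the chart c is a function of the coordinate x in chart_img c, and the expressions
   in two charts are related by the tensor transformation law. Values at other x are irrelevant.
   A k-form takes the list of its k arguments; 'b is real or complex. *)
type_synonym 'a vfield = "'a chart \<Rightarrow> real^7 \<Rightarrow> real^7"
type_synonym 'a metric = "'a chart \<Rightarrow> real^7 \<Rightarrow> real^7 \<Rightarrow> real^7 \<Rightarrow> real"
type_synonym 'a endo = "'a chart \<Rightarrow> real^7 \<Rightarrow> real^7 \<Rightarrow> real^7"
type_synonym ('a, 'b) form = "'a chart \<Rightarrow> real^7 \<Rightarrow> (real^7) list \<Rightarrow> 'b"

definition vector_field :: "'a chart set \<Rightarrow> 'a vfield \<Rightarrow> bool" where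
  "vector_field \<A> X \<longleftrightarrow>
     (\<forall>c\<in>\<A>. smooth_on (chart_img c) (X c)) \<and>
     (\<forall>c\<in>\<A>. \<forall>d\<in>\<A>. \<forall>x\<in>overlap c d. X d (transition c d x) = jac c d x (X c x))"

definition riemannian_metric :: "'a chart set \<Rightarrow> 'a metric \<Rightarrow> bool" where
  "riemannian_metric \<A> g \<longleftrightarrow>
     (\<forall>c\<in>\<A>. \<forall>x\<in>chart_img c. bilinear (g c x) \<and>
        (\<forall>u v. g c x u v = g c x v u) \<and> (\<forall>u. u \<noteq> 0 \<longrightarrow> g c x u u > 0)) \<and>
     (\<forall>c\<in>\<A>. \<forall>u v. smooth_on (chart_img c) (\<lambda>x. g c x u v)) \<and>
     (\<forall>c\<in>\<A>. \<forall>d\<in>\<A>. \<forall>x\<in>overlap c d. \<forall>u v.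
        g d (transition c d x) (jac c d x u) (jac c d x v) = g c x u v)"

definition alternating_form ::
  "nat \<Rightarrow> ((real^7) list \<Rightarrow> 'b::real_vector) \<Rightarrow> bool" where
  "alternating_form k \<alpha> \<longleftrightarrow>
     (\<forall>vs. length vs = k \<longrightarrow>
        (\<forall>i<k. linear (\<lambda>u. \<alpha> (vs[i := u]))) \<and>
        (\<forall>i j. i < j \<and> j < k \<and> vs ! i = vs ! j \<longrightarrow> \<alpha> vs = 0))"

definition differential_form ::
  "'a chart set \<Rightarrow> nat \<Rightarrow> ('a, 'b::real_normed_field) form \<Rightarrow> bool" where
  "differential_form \<A> k \<alpha> \<longleftrightarrow>
     (\<forall>c\<in>\<A>. \<forall>x\<in>chart_img c. alternating_form k (\<alpha> c x)) \<and>
     (\<forall>c\<in>\<A>. \<forall>vs. length vs = k \<longrightarrow> smooth_on (chart_img c) (\<lambda>x. \<alpha> c x vs)) \<and>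
     (\<forall>c\<in>\<A>. \<forall>d\<in>\<A>. \<forall>x\<in>overlap c d. \<forall>vs. length vs = k \<longrightarrow>
        \<alpha> d (transition c d x) (map (jac c d x) vs) = \<alpha> c x vs)"

(* Wedge product of a k-form with a form of any degree, as the signed sum over shuffles: I is the
   set of positions of the arguments passed to alpha, and the sign is that of the shuffle.
   Normalisation: (a wedge b)(u,v) = a(u) b(v) - a(v) b(u) for 1-forms. *)
definition wedge :: "nat \<Rightarrow> ('a, 'b::real_normed_field) form \<Rightarrow> ('a, 'b) form \<Rightarrow> ('a, 'b) form" where
  "wedge k \<alpha> \<beta> = (\<lambda>c x vs. \<Sum>I | I \<subseteq> {..<length vs} \<and> card I = k.
     (-1) ^ card {(i, j). i \<in> I \<and> j \<in> {..<length vs} - I \<and> j < i}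
       * \<alpha> c x (nths vs I) * \<beta> c x (nths vs (- I)))"

(* (d alpha)(v_0,...,v_k) = sum_i (-1)^i D_{v_i} alpha(v_0,..., omit v_i,...,v_k); for 1-forms
   this is X(alpha(Y)) - Y(alpha(X)) - alpha([X,Y]). *)
definition ext_deriv :: "('a, 'b::real_normed_field) form \<Rightarrow> ('a, 'b) form" where
  "ext_deriv \<alpha> = (\<lambda>c x vs. \<Sum>i<length vs. (-1) ^ i *
     frechet_derivative (\<lambda>y. \<alpha> c y (take i vs @ drop (Suc i) vs)) (at x) (vs ! i))"

definition lie_bracket :: "'a vfield \<Rightarrow> 'a vfield \<Rightarrow> 'a vfield" where
  "lie_bracket X Y = (\<lambda>c x.
     frechet_derivative (Y c) (at x) (X c x) - frechet_derivative (X c) (at x) (Y c x))"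


section \<open>Riemannian geometry\<close>

(* Christoffel symbols of the Levi-Civita connection in the chart c, as a bilinear map, via the
   Koszul formula for constant-coefficient fields. *)
definition christoffel ::
  "'a metric \<Rightarrow> 'a chart \<Rightarrow> real^7 \<Rightarrow> real^7 \<Rightarrow> real^7 \<Rightarrow> real^7" where
  "christoffel g c x u v = (THE w. \<forall>z. 2 * g c x w z =
      frechet_derivative (\<lambda>y. g c y v z) (at x) u
    + frechet_derivative (\<lambda>y. g c y u z) (at x) v
    - frechet_derivative (\<lambda>y. g c y u v) (at x) z)"

(* nabla g X c x u is the covariant derivative of X in the direction u. *)
definition nabla :: "'a metric \<Rightarrow> 'a vfield \<Rightarrow> 'a endo" where
  "nabla g X = (\<lambda>c x u. frechet_derivative (X c) (at x) u + christoffel g c x u (X c x))"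

(* nabla_endo g P c x u v = (nabla_u P)(v). *)
definition nabla_endo :: "'a metric \<Rightarrow> 'a endo \<Rightarrow> 'a chart \<Rightarrow> real^7 \<Rightarrow> real^7 \<Rightarrow> real^7 \<Rightarrow> real^7" where
  "nabla_endo g P = (\<lambda>c x u v. frechet_derivative (\<lambda>y. P c y v) (at x) u
     + christoffel g c x u (P c x v) - P c x (christoffel g c x u v))"

(* Geodesic completeness: every initial condition extends to a geodesic defined on all of R. *)
definition complete_metric :: "'a::topological_space chart set \<Rightarrow> 'a metric \<Rightarrow> bool" where
  "complete_metric \<A> g \<longleftrightarrow>
     (\<forall>c\<in>\<A>. \<forall>p\<in>fst c. \<forall>v. \<exists>\<gamma> :: real \<Rightarrow> 'a.
        continuous_on UNIV \<gamma> \<and> \<gamma> 0 = p \<and> ((snd c \<circ> \<gamma>) has_vector_derivative v) (at 0) \<and>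
        (\<forall>d\<in>\<A>. \<forall>s. \<gamma> s \<in> fst d \<longrightarrow>
           (let y = snd d \<circ> \<gamma>; y' = (\<lambda>r. vector_derivative y (at r)) in
             y differentiable (at s) \<and>
             (y' has_vector_derivative - christoffel g d (y s) (y' s) (y' s)) (at s))))"

(* The Lie derivative of g along X vanishes. *)
definition killing_field :: "'a chart set \<Rightarrow> 'a metric \<Rightarrow> 'a vfield \<Rightarrow> bool" where
  "killing_field \<A> g X \<longleftrightarrow> vector_field \<A> X \<and>
     (\<forall>c\<in>\<A>. \<forall>x\<in>chart_img c. \<forall>u v.
        frechet_derivative (\<lambda>y. g c y u v) (at x) (X c x)
        + g c x (frechet_derivative (X c) (at x) u) v
        + g c x u (frechet_derivative (X c) (at x) v) = 0)"

(* Boyer and Galicki: a unit Killing field X induces a Sasakian structure if P = - nabla X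
   satisfies (nabla_u P) v = g(u,v) X - g(X,v) u. *)
definition sasakian_field :: "'a chart set \<Rightarrow> 'a metric \<Rightarrow> 'a vfield \<Rightarrow> bool" where
  "sasakian_field \<A> g X \<longleftrightarrow> killing_field \<A> g X \<and>
     (\<forall>c\<in>\<A>. \<forall>x\<in>chart_img c. g c x (X c x) (X c x) = 1 \<and>
        (\<forall>u v. nabla_endo g (\<lambda>c x w. - nabla g X c x w) c x u v
           = g c x u v *\<^sub>R X c x - g c x (X c x) v *\<^sub>R u))"


section \<open>3-Sasakian 7-manifolds\<close>

(* The three fields are indexed by the cyclic type 3 (so 1 + 1 = 2, 2 + 1 = 3, 3 + 1 = 1), and the
   cyclic triples (i,j,k) are exactly the triples (i, i+1, i+2); the remaining cases of
   [xi_i, xi_j] = 2 eps_ijk xi_k follow by antisymmetry of the bracket. *)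
definition three_sasakian ::
  "'a::topological_space chart set \<Rightarrow> 'a metric \<Rightarrow> (3 \<Rightarrow> 'a vfield) \<Rightarrow> bool" where
  "three_sasakian \<A> g \<xi> \<longleftrightarrow>
     connected (UNIV :: 'a set) \<and> smooth_atlas \<A> \<and> riemannian_metric \<A> g \<and> complete_metric \<A> g \<and>
     (\<forall>i. killing_field \<A> g (\<xi> i)) \<and> (\<forall>i. sasakian_field \<A> g (\<xi> i)) \<and>
     (\<forall>c\<in>\<A>. \<forall>x\<in>chart_img c.
        (\<forall>i j. g c x (\<xi> i c x) (\<xi> j c x) = (if i = j then 1 else 0)) \<and>
        (\<forall>i. lie_bracket (\<xi> i) (\<xi> (i + 1)) c x = 2 *\<^sub>R \<xi> (i + 2) c x))"

(* The connection form eta_i: it vanishes on the orthogonal complement H of the orbits, and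
   eta_i(xi_j) = delta_ij. *)
definition eta :: "'a metric \<Rightarrow> (3 \<Rightarrow> 'a vfield) \<Rightarrow> 3 \<Rightarrow> ('a, real) form" where
  "eta g \<xi> i = (\<lambda>c x vs. g c x (\<xi> i c x) (vs ! 0))"

(* eta_i wedge eta_j *)
definition eta2 :: "'a metric \<Rightarrow> (3 \<Rightarrow> 'a vfield) \<Rightarrow> 3 \<Rightarrow> 3 \<Rightarrow> ('a, real) form" where
  "eta2 g \<xi> i j = wedge 1 (eta g \<xi> i) (eta g \<xi> j)"

(* The curvature equation d eta_i + 2 eta_j wedge eta_k = -2 omega_i, for (i,j,k) cyclic, solved
   for omega_i. *)
definition omega :: "'a metric \<Rightarrow> (3 \<Rightarrow> 'a vfield) \<Rightarrow> 3 \<Rightarrow> ('a, real) form" where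
  "omega g \<xi> i = (\<lambda>c x vs.
     - (1/2) * (ext_deriv (eta g \<xi> i) c x vs + 2 * eta2 g \<xi> (i + 1) (i + 2) c x vs))"

definition horizontal_frame ::
  "'a metric \<Rightarrow> (3 \<Rightarrow> 'a vfield) \<Rightarrow> 'a chart \<Rightarrow> real^7 \<Rightarrow> (real^7) list \<Rightarrow> bool" where
  "horizontal_frame g \<xi> c x es \<longleftrightarrow> length es = 4 \<and>
     (\<forall>a<4. \<forall>i. g c x (\<xi> i c x) (es ! a) = 0) \<and>
     (\<forall>a<4. \<forall>b<4. g c x (es ! a) (es ! b) = (if a = b then 1 else 0))"

(* nu is the pullback to X of the volume form of the leaf space Z. Since the projection is a
   Riemannian submersion, this is the 4-form which is killed by the vertical fields and restricts
   to the volume form of (H, g|H) for the orientation in which omega_1, omega_2, omega_3 are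
   sections of Lambda^2_+ H. Self-duality is the equation omega(e0,e1) = omega(e2,e3) in all
   oriented orthonormal frames; the other two components follow by permuting e1,e2,e3
   cyclically. *)
definition pullback_volume ::
  "'a chart set \<Rightarrow> 'a metric \<Rightarrow> (3 \<Rightarrow> 'a vfield) \<Rightarrow> ('a, real) form \<Rightarrow> bool" where
  "pullback_volume \<A> g \<xi> \<nu> \<longleftrightarrow> differential_form \<A> 4 \<nu> \<and>
     (\<forall>c\<in>\<A>. \<forall>x\<in>chart_img c.
        (\<forall>i u v w. \<nu> c x [\<xi> i c x, u, v, w] = 0) \<and>
        (\<forall>es. horizontal_frame g \<xi> c x es \<longrightarrow> \<bar>\<nu> c x es\<bar> = 1) \<and>
        (\<forall>es. horizontal_frame g \<xi> c x es \<and> \<nu> c x es = 1 \<longrightarrow>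
           (\<forall>i. omega g \<xi> i c x [es ! 0, es ! 1] = omega g \<xi> i c x [es ! 2, es ! 3])))"

definition psi ::
  "'a metric \<Rightarrow> (3 \<Rightarrow> 'a vfield) \<Rightarrow> ('a, real) form \<Rightarrow> real \<Rightarrow> real \<Rightarrow> ('a, real) form" where
  "psi g \<xi> \<nu> t \<epsilon> = (\<lambda>c x vs. \<nu> c x vs - t\<^sup>2 *
     (\<epsilon> * wedge 2 (eta2 g \<xi> 2 3) (omega g \<xi> 1) c x vs
    + \<epsilon> * wedge 2 (eta2 g \<xi> 3 1) (omega g \<xi> 2) c x vs
    + wedge 2 (eta2 g \<xi> 1 2) (omega g \<xi> 3) c x vs))"


section \<open>Deformed G2-instantons on the trivial line bundle\<close>

(* Relative to the trivial flat connection, unitary connections on the trivial complex line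
   bundle are the 1-forms with values in i R. *)
definition unitary_connection :: "'a chart set \<Rightarrow> ('a, complex) form \<Rightarrow> bool" where
  "unitary_connection \<A> A \<longleftrightarrow> differential_form \<A> 1 A \<and>
     (\<forall>c\<in>\<A>. \<forall>x\<in>chart_img c. \<forall>v. Re (A c x [v]) = 0)"

abbreviation curvature :: "('a, complex) form \<Rightarrow> ('a, complex) form" where
  "curvature A \<equiv> ext_deriv A"

definition deformed_G2_instanton ::
  "'a chart set \<Rightarrow> ('a, real) form \<Rightarrow> ('a, complex) form \<Rightarrow> bool" where
  "deformed_G2_instanton \<A> \<psi> A \<longleftrightarrow> unitary_connection \<A> A \<and>
     (let F = curvature A in
       \<forall>c\<in>\<A>. \<forall>x\<in>chart_img c. \<forall>vs. length vs = 6 \<longrightarrow>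
         1/6 * wedge 4 (wedge 2 F F) F c x vs
         + wedge 2 F (\<lambda>c x us. complex_of_real (\<psi> c x us)) c x vs = 0)"

(* i (a_1 eta_1 + a_2 eta_2 + a_3 eta_3) *)
definition eta_connection ::
  "'a metric \<Rightarrow> (3 \<Rightarrow> 'a vfield) \<Rightarrow> real^3 \<Rightarrow> ('a, complex) form" where
  "eta_connection g \<xi> a = (\<lambda>c x vs. \<i> * complex_of_real (\<Sum>i\<in>UNIV. a $ i * eta g \<xi> i c x vs))"

end

(*
Write P_i for the covariant derivative of xi_i. The Killing equation gives d eta_i (u, v) = 2 g(P_i u, v),
and differentiating P_i xi_j (a known multiple of some xi_k) with the Sasakian identity shows that
P_1, P_2, P_3 act on the horizontal space H like the imaginary quaternions, up to sign. So a unit vector e in H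
yields the orthonormal frame xi_1, xi_2, xi_3, e, E_i = - P_i e, in which all d eta_i, omega_i and nu are
explicit; self-duality of the omega_i forces nu(e, E_1, E_2, E_3) = 1.
The deformed instanton form is alternating of degree 6, hence is determined by its values on the seven
6-tuples of frame vectors. It vanishes when all three xi_i occur, and omitting xi_i leaves
a_i (4 |a|^2 - 1 + 2 t^2 epsilon_i) up to a nonzero factor, where epsilon_1 = epsilon_2 = epsilon and
epsilon_3 = 1.
*)
theory Submission
  imports Defs
begin

section \<open>Wedge products of alternating forms\<close>

text \<open>The frame vectors exist at one point only and are never differentiated. Once
  \<open>ext_deriv_eta\<close> has turned the exterior derivative into \<open>N i\<close>, the
  covariant derivative of \<open>\<xi> i\<close>, every form in the equation is algebraic in
  \<open>g\<close>, the three fields and \<open>N i\<close>. The endomorphism \<open>N i\<close>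
  itself is differentiated in just one place, the Sasakian identity, and there only against the
  fields \<open>\<xi> j\<close>, whose images under \<open>N i\<close> are known. Even this needs
  differentiable Christoffel symbols, whereas \<open>christoffel\<close> is a definite description;
  Cramer's rule bridges that gap. The final computation is short because everything has even
  vertical degree: the curvature is \<open>- 2 * \<i>\<close> times the sum of a_i (omega_i + eta_j
  wedge eta_k), with no term mixing vertical and horizontal directions.\<close>

lemma wedge_0: "wedge 0 \<alpha> \<beta> c x vs = \<alpha> c x [] * \<beta> c x vs"
proof -
  have "{I. I \<subseteq> {..<length vs} \<and> card I = 0} = {{}}"
    by (auto dest: finite_subset)
  then show ?thesis by (simp add: wedge_def nths_all)
qed

lemma wedge_Nil: "wedge (Suc k) \<alpha> \<beta> c x [] = 0"
proof -
  have "{I. I \<subseteq> {..<0::nat} \<and> card I = Suc k} = {}" by auto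
  then show ?thesis by (simp add: wedge_def)
qed

text \<open>A shuffle gives the first argument either to \<open>\<alpha>\<close> or to
  \<open>\<beta>\<close>. In the second case each of the \<open>Suc k\<close> positions kept for
  \<open>\<alpha>\<close> gains one inversion with position 0, whence the sign. This recursion
  drives the inductions and the explicit expansions below.\<close>

lemma wedge_Cons:
  "wedge (Suc k) \<alpha> \<beta> c x (v # vs) =
     wedge k (\<lambda>c x us. \<alpha> c x (v # us)) \<beta> c x vs
     + (-1) ^ Suc k * wedge (Suc k) \<alpha> (\<lambda>c x us. \<beta> c x (v # us)) c x vs"
proof -
  define n where "n = length vs"
  define inv where "inv I m = {(i, j). i \<in> I \<and> j \<in> {..<m::nat} - I \<and> j < i}" for I m
  define tm where "tm I = (-1) ^ card (inv I (Suc n))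
       * \<alpha> c x (nths (v # vs) I) * \<beta> c x (nths (v # vs) (- I))" for I
  define S where "S k m = {I. I \<subseteq> {..<m::nat} \<and> card I = k}" for k m
  have Sprops: "finite J" "card J = k" "J \<subseteq> {..<n}" if "J \<in> S k n" for J k
    using that by (auto simp: S_def intro: finite_subset)
  have fin_inv: "finite (inv J n)" if "J \<subseteq> {..<n}" for J
    by (rule finite_subset[of _ "{..<n} \<times> {..<n}"]) (use that in \<open>auto simp: inv_def\<close>)
  have card_mp: "card (map_prod Suc Suc ` X) = card X" for X
    by (rule card_image) (auto simp: inj_on_def)
  have split: "S (Suc k) (Suc n) = (\<lambda>J. insert 0 (Suc ` J)) ` S k n \<union> (`) Suc ` S (Suc k) n"
  proof (intro equalityI subsetI)
    fix I assume I: "I \<in> S (Suc k) (Suc n)"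
    define J where "J = {j. Suc j \<in> I}"
    have J: "J \<subseteq> {..<n}" using I by (auto simp: S_def J_def)
    then have fin: "finite J" by (rule finite_subset) simp
    show "I \<in> (\<lambda>J. insert 0 (Suc ` J)) ` S k n \<union> (`) Suc ` S (Suc k) n"
    proof (cases "0 \<in> I")
      case True
      then have eq: "I = insert 0 (Suc ` J)"
        by (auto simp: J_def image_iff) (metis not0_implies_Suc)
      then have "card I = Suc (card J)" using fin by (simp add: card_image)
      then show ?thesis using eq I J by (auto simp: S_def)
    next
      case False
      then have eq: "I = Suc ` J"
        by (auto simp: J_def image_iff) (metis not0_implies_Suc)
      then have "card I = card J" by (simp add: card_image)
      then show ?thesis using eq I J by (auto simp: S_def)
    qed
  qed (auto simp: S_def card_image card_insert_if finite_subset)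
  have fin: "finite (S k m)" for k m
    by (rule finite_subset[of _ "Pow {..<m}"]) (auto simp: S_def)
  have t1: "tm (insert 0 (Suc ` J)) = (-1) ^ card (inv J n)
      * \<alpha> c x (v # nths vs J) * \<beta> c x (nths vs (- J))" if "J \<in> S k n" for J
  proof -
    have "inv (insert 0 (Suc ` J)) (Suc n) = map_prod Suc Suc ` inv J n"
    proof (intro equalityI subsetI)
      fix p assume "p \<in> inv (insert 0 (Suc ` J)) (Suc n)"
      then obtain i j where p: "p = (Suc i, Suc j)" "i \<in> J" "j < n" "j \<notin> J" "j < i"
        by (cases p; cases "fst p"; cases "snd p") (auto simp: inv_def)
      then show "p \<in> map_prod Suc Suc ` inv J n"
        by (auto simp: inv_def intro!: image_eqI[of _ _ "(i, j)"])
    qed (auto simp: inv_def)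
    then have "card (inv (insert 0 (Suc ` J)) (Suc n)) = card (inv J n)"
      by (simp add: card_mp)
    moreover have "{j. Suc j \<in> insert 0 (Suc ` J)} = J" "{j. Suc j \<in> - insert 0 (Suc ` J)} = - J"
      by auto
    ultimately show ?thesis by (simp add: tm_def nths_Cons)
  qed
  have t2: "tm (Suc ` J) = (-1) ^ Suc k * ((-1) ^ card (inv J n)
      * \<alpha> c x (nths vs J) * \<beta> c x (v # nths vs (- J)))" if "J \<in> S (Suc k) n" for J
  proof -
    have "inv (Suc ` J) (Suc n) = map_prod Suc Suc ` inv J n \<union> (Suc ` J) \<times> {0}"
    proof (intro equalityI subsetI)
      fix p assume p: "p \<in> inv (Suc ` J) (Suc n)"
      show "p \<in> map_prod Suc Suc ` inv J n \<union> (Suc ` J) \<times> {0}"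
      proof (cases "snd p")
        case 0 then show ?thesis using p by (cases p) (auto simp: inv_def)
      next
        case (Suc j)
        then obtain i where "p = (Suc i, Suc j)" "i \<in> J" "j < n" "j \<notin> J" "j < i"
          using p by (cases p; cases "fst p") (auto simp: inv_def)
        then show ?thesis
          by (auto simp: inv_def intro!: image_eqI[of _ _ "(i, j)"])
      qed
    qed (auto simp: inv_def)
    moreover have "map_prod Suc Suc ` inv J n \<inter> (Suc ` J) \<times> {0} = {}" by auto
    ultimately have "card (inv (Suc ` J) (Suc n)) = card (inv J n) + Suc k"
      using Sprops[OF that] fin_inv
      by (simp add: card_Un_disjoint card_mp card_image card_cartesian_product)
    moreover have "{j. Suc j \<in> Suc ` J} = J" "{j. Suc j \<in> - Suc ` J} = - J"
      by auto
    ultimately show ?thesis by (simp add: tm_def nths_Cons power_add)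
  qed
  have "wedge (Suc k) \<alpha> \<beta> c x (v # vs) = sum tm (S (Suc k) (Suc n))"
    by (simp add: wedge_def tm_def inv_def S_def n_def)
  also have "\<dots> = sum tm ((\<lambda>J. insert 0 (Suc ` J)) ` S k n) + sum tm ((`) Suc ` S (Suc k) n)"
    unfolding split by (rule sum.union_disjoint) (use fin in auto)
  also have "sum tm ((\<lambda>J. insert 0 (Suc ` J)) ` S k n)
      = (\<Sum>J\<in>S k n. tm (insert 0 (Suc ` J)))"
  proof (rule sum.reindex_cong)
    show "inj_on (\<lambda>J. insert 0 (Suc ` J)) (S k n)"
    proof (rule inj_onI)
      fix A B :: "nat set" assume "insert 0 (Suc ` A) = insert 0 (Suc ` B)"
      then have "Suc ` A = Suc ` B" by blast
      then show "A = B" by (simp add: inj_image_eq_iff)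
    qed
  qed auto
  also have "sum tm ((`) Suc ` S (Suc k) n) = (\<Sum>J\<in>S (Suc k) n. tm (Suc ` J))"
    by (rule sum.reindex_cong) (auto simp: inj_on_def inj_image_eq_iff)
  also have "(\<Sum>J\<in>S k n. tm (insert 0 (Suc ` J)))
      = wedge k (\<lambda>c x us. \<alpha> c x (v # us)) \<beta> c x vs"
    by (subst sum.cong[OF refl t1], assumption) (simp add: wedge_def S_def inv_def n_def)
  also have "(\<Sum>J\<in>S (Suc k) n. tm (Suc ` J))
      = (-1) ^ Suc k * wedge (Suc k) \<alpha> (\<lambda>c x us. \<beta> c x (v # us)) c x vs"
    by (subst sum.cong[OF refl t2], assumption, subst sum_distrib_left[symmetric]) (simp add: wedge_def S_def inv_def n_def)
  finally show ?thesis .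
qed

text \<open>Linearity in the first slot and antisymmetry under adjacent transpositions characterise
  alternating forms and, unlike \<^const>\<open>alternating_form\<close>, propagate directly along the recursion
  for the wedge product.\<close>

definition skew_form :: "nat \<Rightarrow> ((real^7) list \<Rightarrow> 'b::real_vector) \<Rightarrow> bool" where
  "skew_form k f \<longleftrightarrow>
     (\<forall>us. Suc (length us) = k \<longrightarrow> linear (\<lambda>u. f (u # us))) \<and>
     (\<forall>us x y vs. length us + length vs + 2 = k \<longrightarrow> f (us @ x # y # vs) = - f (us @ y # x # vs))"

lemma skew_form_linear: "skew_form k f \<Longrightarrow> Suc (length us) = k \<Longrightarrow> linear (\<lambda>u. f (u # us))"
  by (simp add: skew_form_def)

lemma skew_form_swap:
  "skew_form k f \<Longrightarrow> length us + length vs + 2 = k \<Longrightarrow> f (us @ x # y # vs) = - f (us @ y # x # vs)"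
  unfolding skew_form_def by blast

text \<open>Contraction with a fixed first argument. Linearity in the new first slot is that of the
  old one, reached by a single transposition.\<close>

lemma skew_form_Cons:
  assumes "skew_form (Suc k) f" shows "skew_form k (\<lambda>us. f (v # us))"
proof -
  have "linear (\<lambda>u. f (v # u # us))" if "Suc (length us) = k" for us
  proof -
    have "(\<lambda>u. f (v # u # us)) = (\<lambda>u. - f (u # v # us))"
      using skew_form_swap[OF assms, of "[]" us v] that by (intro ext) simp
    then show ?thesis
      using skew_form_linear[OF assms, of "v # us"] that by (simp add: linear_compose_neg)
  qed
  moreover have "f (v # us @ x # y # vs) = - f (v # us @ y # x # vs)"
    if "length us + length vs + 2 = k" for us x y vs
    using skew_form_swap[OF assms, of "v # us" vs x y] that by simp
  ultimately show ?thesis unfolding skew_form_def by blast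
qed

lemma alternating_imp_skew_form:
  assumes "alternating_form k \<alpha>" shows "skew_form k \<alpha>"
proof -
  have lin: "linear (\<lambda>u. \<alpha> (vs[i := u]))" if "length vs = k" "i < k" for vs i
    using assms that by (simp add: alternating_form_def)
  have alt: "\<alpha> vs = 0" if "length vs = k" "i < j" "j < k" "vs ! i = vs ! j" for vs i j
    using assms that unfolding alternating_form_def by blast
  have "linear (\<lambda>u. \<alpha> (u # us))" if "Suc (length us) = k" for us
    using lin[of "0 # us" 0] that by simp
  moreover have "\<alpha> (us @ x # y # vs) = - \<alpha> (us @ y # x # vs)"
    if len: "length us + length vs + 2 = k" for us x y vs
  proof -
    let ?i = "length us"
    have l1: "linear (\<lambda>u. \<alpha> (us @ u # w # vs))" for w
      using lin[of "us @ 0 # w # vs" ?i] len by simp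
    have l2: "linear (\<lambda>w. \<alpha> (us @ u # w # vs))" for u
      using lin[of "us @ u # 0 # vs" "Suc ?i"] len by (simp add: list_update_append)
    have z: "\<alpha> (us @ w # w # vs) = 0" for w
      by (rule alt[of _ ?i "Suc ?i"]) (use len in \<open>auto simp: nth_append\<close>)
    \<comment> \<open>Polarization: both diagonal terms of the expansion vanish.\<close>
    have "0 = \<alpha> (us @ (x + y) # (x + y) # vs)" by (simp only: z)
    also have "\<dots> = \<alpha> (us @ x # (x + y) # vs) + \<alpha> (us @ y # (x + y) # vs)"
      by (rule linear_add[OF l1])
    also have "\<dots> = \<alpha> (us @ x # y # vs) + \<alpha> (us @ y # x # vs)"
      by (simp add: linear_add[OF l2] z)
    finally show ?thesis by (metis eq_neg_iff_add_eq_0)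
  qed
  ultimately show ?thesis unfolding skew_form_def by blast
qed

text \<open>Adjacent transpositions generate all permutations and change only the sign. As only
  vanishing is asked for, the sign of the permutation need not be tracked. The prefix
  \<open>us\<close> holds the entries already in place.\<close>

lemma skew_form_perm_zero:
  assumes f: "skew_form k f" and "mset xs = mset ys" "length us + length xs = k"
    "f (us @ xs) = 0"
  shows "f (us @ ys) = 0"
  using assms(2-4)
proof (induction xs arbitrary: us ys)
  case (Cons x xs)
  then obtain ys1 ys2 where ys: "ys = ys1 @ x # ys2"
    by (metis list.set_intros(1) set_mset_mset split_list)
  have "f ((us @ [x]) @ (ys1 @ ys2)) = 0"
    by (rule Cons.IH) (use Cons.prems ys in auto)
  moreover have "length us + length (ys1 @ ys2) + 1 = k"
    using Cons.prems ys by (metis add.assoc length_append length_Cons mset_eq_length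
        add_Suc_right Suc_eq_plus1)
  then have "f (us @ ys1 @ x # ys2) = 0" if "f (us @ x # ys1 @ ys2) = 0"
    using that
  proof (induction ys1 arbitrary: us)
    case (Cons y ys1)
    have "f (us @ y # x # ys1 @ ys2) = 0"
      using skew_form_swap[OF f, of us "ys1 @ ys2" x y] Cons.prems by simp
    then show ?case using Cons.IH[of "us @ [y]"] Cons.prems by simp
  qed simp
  ultimately show ?case by (simp add: ys)
qed simp

lemma skew_form_eq_0_if_basis:
  assumes f: "skew_form k f" and span: "span B = UNIV"
    and basis: "\<And>bs. set bs \<subseteq> B \<Longrightarrow> distinct bs \<Longrightarrow> length bs = k \<Longrightarrow> f bs = 0"
    and len: "length vs = k"
  shows "f vs = 0"
proof -
  have B: "f bs = 0" if bs: "set bs \<subseteq> B" "length bs = k" for bs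
  proof (cases "distinct bs")
    case True then show ?thesis using basis bs by blast
  next
    case False
    then obtain us ws zs y where eq: "bs = us @ [y] @ ws @ [y] @ zs"
      using not_distinct_decomp by blast
    \<comment> \<open>With the repeated vector in the first two slots, antisymmetry makes the value
      its own negative.\<close>
    have "f (y # y # us @ ws @ zs) = - f (y # y # us @ ws @ zs)"
      using skew_form_swap[OF f, of "[]" "us @ ws @ zs" y y] bs eq by simp
    then have "2 *\<^sub>R f (y # y # us @ ws @ zs) = 0"
      by (metis eq_neg_iff_add_eq_0 scaleR_2)
    then have "f (y # y # us @ ws @ zs) = 0" by simp
    then show ?thesis
      using skew_form_perm_zero[OF f, of "y # y # us @ ws @ zs" bs "[]"] bs eq by simp
  qed
  \<comment> \<open>Basis vectors are exchanged for arbitrary ones one slot at a time. Each such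
    slot is permuted to the front, the only place where linearity is given.\<close>
  have "f (us @ bs) = 0" if "set bs \<subseteq> B" "length us + length bs = k" for us bs
    using that
  proof (induction us arbitrary: bs)
    case Nil then show ?case using B by simp
  next
    case (Cons u us)
    have lin: "linear (\<lambda>u. f (u # us @ bs))"
      by (rule skew_form_linear[OF f]) (use Cons.prems in simp)
    have "f (b # us @ bs) = 0" if "b \<in> B" for b
    proof -
      have "f (us @ b # bs) = 0" using Cons that by simp
      then show ?thesis
        using skew_form_perm_zero[OF f, of "us @ b # bs" "b # us @ bs" "[]"] Cons.prems by simp
    qed
    then have "f (u # us @ bs) = 0"
      using linear_eq_0_on_span[OF lin, of B u] span by simp
    then show ?case by simp
  qed
  from this[of "[]" vs] show ?thesis using len by simp
qed

section \<open>Wedge products of skew forms\<close>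

lemma length_nths_subset:
  assumes "I \<subseteq> {..<length vs}" "card I = k"
  shows "length (nths vs I) = k" "length (nths vs (- I)) + k = length vs"
proof -
  have "{i. i < length vs \<and> i \<in> I} = I" using assms by auto
  then show 1: "length (nths vs I) = k" using assms by (simp add: length_nths)
  have "{i. i < length vs \<and> i \<in> - I} = {..<length vs} - I" by auto
  then show "length (nths vs (- I)) + k = length vs"
    using assms card_mono[OF _ assms(1)]
    by (simp add: length_nths card_Diff_subset finite_subset[OF assms(1)])
qed

lemma wedge_cong:
  assumes "\<And>us. length us = k \<Longrightarrow> \<alpha> c x us = \<alpha>' c x us"
    and "\<And>us. length us + k = length vs \<Longrightarrow> \<beta> c x us = \<beta>' c x us"
  shows "wedge k \<alpha> \<beta> c x vs = wedge k \<alpha>' \<beta>' c x vs"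
  unfolding wedge_def by (rule sum.cong) (auto simp: assms length_nths_subset)

lemma wedge_minus_left: "wedge k (\<lambda>c x us. - \<alpha> c x us) \<beta> c x vs = - wedge k \<alpha> \<beta> c x vs"
  by (simp add: wedge_def sum_negf)

lemma wedge_minus_right: "wedge k \<alpha> (\<lambda>c x us. - \<beta> c x us) c x vs = - wedge k \<alpha> \<beta> c x vs"
  by (simp add: wedge_def sum_negf)

lemma wedge_short: "length vs < k \<Longrightarrow> wedge k \<alpha> \<beta> c x vs = 0"
proof -
  assume *: "length vs < k"
  have "card I < k" if "I \<subseteq> {..<length vs}" for I
    using card_mono[OF _ that] * by simp
  then have "{I. I \<subseteq> {..<length vs} \<and> card I = k} = {}" by blast
  then show ?thesis unfolding wedge_def by (simp only: sum.empty)
qed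

text \<open>The families \<open>A u\<close> and \<open>B u\<close> stand for the contractions that
  \<open>wedge_Cons\<close> produces from a first argument \<open>u\<close>.\<close>

lemma linear_wedge:
  fixes A B :: "real^7 \<Rightarrow> ('a, 'b::real_normed_field) form"
  shows "(\<And>us. length us = k \<Longrightarrow> linear (\<lambda>u. A u c x us)) \<Longrightarrow> linear (\<lambda>u. wedge k (A u) \<beta> c x vs)"
    and "(\<And>us. length us + k = length vs \<Longrightarrow> linear (\<lambda>u. B u c x us)) \<Longrightarrow>
      linear (\<lambda>u. wedge k \<alpha> (B u) c x vs)"
proof -
  have "linear (\<lambda>u. s * f u * r)" if "linear f" for s r and f :: "real^7 \<Rightarrow> 'b"
    using that by (simp add: linear_iff distrib_left distrib_right)
  note l1 = this
  have "linear (\<lambda>u. s * r * f u)" if "linear f" for s r and f :: "real^7 \<Rightarrow> 'b"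
    using that by (simp add: linear_iff distrib_left)
  note l2 = this
  show "linear (\<lambda>u. wedge k (A u) \<beta> c x vs)"
    if "\<And>us. length us = k \<Longrightarrow> linear (\<lambda>u. A u c x us)"
    unfolding wedge_def by (intro linear_compose_sum ballI l1 that length_nths_subset) auto
  show "linear (\<lambda>u. wedge k \<alpha> (B u) c x vs)"
    if "\<And>us. length us + k = length vs \<Longrightarrow> linear (\<lambda>u. B u c x us)"
    unfolding wedge_def by (intro linear_compose_sum ballI l2 that length_nths_subset) auto
qed

text \<open>Once the prefix is used up, the two arguments go both to \<open>\<alpha>\<close>, both
  to \<open>\<beta>\<close>, or one to each. In the first two cases the skewness of the factor
  applies; the two mixed terms carry opposite signs and are interchanged.\<close>

lemma wedge_swap:
  assumes "skew_form k (\<alpha> c x)" "skew_form m (\<beta> c x)" "length us + length vs + 2 = k + m"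
  shows "wedge k \<alpha> \<beta> c x (us @ y # z # vs) = - wedge k \<alpha> \<beta> c x (us @ z # y # vs)"
  using assms
proof (induction us arbitrary: k \<alpha> m \<beta>)
  case Nil
  have \<beta>: "wedge k \<alpha> (\<lambda>c x us. \<beta> c x (y # z # us)) c x vs
      = - wedge k \<alpha> (\<lambda>c x us. \<beta> c x (z # y # us)) c x vs"
    unfolding wedge_minus_right[symmetric]
    by (rule wedge_cong) (use Nil skew_form_swap[OF Nil(2), of "[]" _ y z] in auto)
  consider "k = 0" | "k = 1" | j where "k = Suc (Suc j)"
    by (metis One_nat_def not0_implies_Suc)
  then show ?case
  proof cases
    case 1
    then show ?thesis using \<beta> by (simp add: wedge_0)
  next
    case 2
    then show ?thesis using \<beta> by (simp add: wedge_Cons wedge_0)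
  next
    case 3
    have \<alpha>: "wedge j (\<lambda>c x us. \<alpha> c x (y # z # us)) \<beta> c x vs
      = - wedge j (\<lambda>c x us. \<alpha> c x (z # y # us)) \<beta> c x vs"
      unfolding wedge_minus_left[symmetric]
      by (rule wedge_cong) (use Nil(1) 3 skew_form_swap[OF Nil(1), of "[]" _ y z] in auto)
    show ?thesis using \<alpha> \<beta> unfolding 3 by (simp add: wedge_Cons algebra_simps)
  qed
next
  case (Cons u us)
  show ?case
  proof (cases k)
    case 0
    then show ?thesis using skew_form_swap[OF Cons.prems(2), of "u # us" vs y z] Cons.prems(3)
      by (simp add: wedge_0)
  next
    case (Suc j)
    have 1: "wedge j (\<lambda>c x us. \<alpha> c x (u # us)) \<beta> c x (us @ y # z # vs)
        = - wedge j (\<lambda>c x us. \<alpha> c x (u # us)) \<beta> c x (us @ z # y # vs)"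
      by (rule Cons.IH[where m = m]) (use Cons.prems Suc in \<open>auto intro: skew_form_Cons\<close>)
    have 2: "wedge k \<alpha> (\<lambda>c x us. \<beta> c x (u # us)) c x (us @ y # z # vs)
        = - wedge k \<alpha> (\<lambda>c x us. \<beta> c x (u # us)) c x (us @ z # y # vs)"
    \<comment> \<open>For \<open>m = 0\<close> the form \<open>\<beta>\<close> has no slot for
      \<open>u\<close>, but then too few arguments remain for \<open>\<alpha>\<close> and the
      shuffle sum is empty.\<close>
    proof (cases m)
      case 0
      then show ?thesis using Cons.prems(3) Suc by (simp add: wedge_short)
    next
      case (Suc l)
      then show ?thesis
        by (intro Cons.IH[where m = l]) (use Cons.prems in \<open>auto intro: skew_form_Cons\<close>)
    qed
    show ?thesis using 1 2 unfolding Suc append_Cons wedge_Cons by simp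
  qed
qed

lemma skew_form_wedge:
  assumes "skew_form k (\<alpha> c x)" "skew_form m (\<beta> c x)"
  shows "skew_form (k + m) (wedge k \<alpha> \<beta> c x)"
proof -
  have "linear (\<lambda>u. wedge k \<alpha> \<beta> c x (u # us))" if us: "Suc (length us) = k + m" for us
  proof (cases k)
    case 0
    have "linear (\<lambda>u. \<alpha> c x [] * \<beta> c x (u # us))"
      using skew_form_linear[OF assms(2), of us] us 0
      by (simp add: linear_iff distrib_left)
    then show ?thesis by (simp add: 0 wedge_0)
  next
    case (Suc j)
    have "linear (\<lambda>u. wedge j (\<lambda>c x us. \<alpha> c x (u # us)) \<beta> c x us)"
      by (rule linear_wedge) (use skew_form_linear[OF assms(1)] Suc in auto)
    moreover have "linear (\<lambda>u. wedge k \<alpha> (\<lambda>c x us. \<beta> c x (u # us)) c x us)"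
      by (rule linear_wedge) (use skew_form_linear[OF assms(2)] us in auto)
    ultimately show ?thesis
      unfolding Suc wedge_Cons
      by (simp add: linear_iff distrib_left scaleR_right_diff_distrib)
  qed
  then show ?thesis unfolding skew_form_def using wedge_swap[of k \<alpha> c x m \<beta>, OF assms] by blast
qed

lemma skew_form_add:
  assumes "skew_form k f" "skew_form k h" shows "skew_form k (\<lambda>vs. f vs + h vs)"
  unfolding skew_form_def
proof (intro conjI allI impI)
  show "linear (\<lambda>u. f (u # us) + h (u # us))" if "Suc (length us) = k" for us
    by (rule linear_compose_add[OF skew_form_linear[OF assms(1) that] skew_form_linear[OF assms(2) that]])
  show "f (us @ p # q # vs) + h (us @ p # q # vs) = - (f (us @ q # p # vs) + h (us @ q # p # vs))"
    if "length us + length vs + 2 = k" for us p q vs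
    using skew_form_swap[OF assms(1) that, of p q] skew_form_swap[OF assms(2) that, of p q]
    by (simp only: minus_add_distrib)
qed

lemma skew_form_linear_compose:
  assumes L: "linear L" and f: "skew_form k f" shows "skew_form k (\<lambda>vs. L (f vs))"
  unfolding skew_form_def
proof (intro conjI allI impI)
  show "linear (\<lambda>u. L (f (u # us)))" if "Suc (length us) = k" for us
    using linear_compose[OF skew_form_linear[OF f that] L] by (simp only: o_def)
  show "L (f (us @ p # q # vs)) = - L (f (us @ q # p # vs))"
    if "length us + length vs + 2 = k" for us p q vs
    using skew_form_swap[OF f that, of p q] by (simp only: linear_neg[OF L])
qed

lemma skew_form_mult_left:
  fixes f :: "_ \<Rightarrow> 'b::real_algebra"
  shows "skew_form k f \<Longrightarrow> skew_form k (\<lambda>vs. r * f vs)"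
  by (rule skew_form_linear_compose[where L = "\<lambda>z. r * z"]) (simp_all add: linear_iff distrib_left)

lemma skew_form_1: "linear (\<lambda>u. f [u]) \<Longrightarrow> skew_form (Suc 0) f"
  by (simp add: skew_form_def)

lemma skew_form_2:
  assumes "\<And>v. linear (\<lambda>u. f [u, v])" "\<And>u v. f [u, v] = - f [v, u]"
  shows "skew_form 2 f"
proof -
  have "linear (\<lambda>u. f (u # us))" if "Suc (length us) = 2" for us
    using that assms(1) by (cases us) auto
  moreover have "f (us @ p # q # vs) = - f (us @ q # p # vs)"
    if "length us + length vs + 2 = 2" for us p q vs
    using that assms(2)[of p q] by simp
  ultimately show ?thesis unfolding skew_form_def by blast
qed

section \<open>Shuffle sums written out in low degree\<close>

lemma wedge_1_pair: "wedge (Suc 0) \<alpha> \<beta> c x [p, q] = \<alpha> c x [p] * \<beta> c x [q] - \<alpha> c x [q] * \<beta> c x [p]"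
  by (simp add: wedge_Cons wedge_0 wedge_Nil)

lemma wedge_2_quad: "wedge 2 \<alpha> \<beta> c x [p, q, r, s] =
    \<alpha> c x [p, q] * \<beta> c x [r, s] - \<alpha> c x [p, r] * \<beta> c x [q, s] + \<alpha> c x [p, s] * \<beta> c x [q, r]
  + \<alpha> c x [q, r] * \<beta> c x [p, s] - \<alpha> c x [q, s] * \<beta> c x [p, r] + \<alpha> c x [r, s] * \<beta> c x [p, q]"
  by (simp add: wedge_Cons wedge_0 wedge_Nil numeral_eq_Suc algebra_simps)

lemma wedge_2_six: "wedge 2 \<alpha> \<beta> c x [p, q, r, s, u, v] =
    \<alpha> c x [p, q] * \<beta> c x [r, s, u, v] - \<alpha> c x [p, r] * \<beta> c x [q, s, u, v]
  + \<alpha> c x [p, s] * \<beta> c x [q, r, u, v] - \<alpha> c x [p, u] * \<beta> c x [q, r, s, v]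
  + \<alpha> c x [p, v] * \<beta> c x [q, r, s, u] + \<alpha> c x [q, r] * \<beta> c x [p, s, u, v]
  - \<alpha> c x [q, s] * \<beta> c x [p, r, u, v] + \<alpha> c x [q, u] * \<beta> c x [p, r, s, v]
  - \<alpha> c x [q, v] * \<beta> c x [p, r, s, u] + \<alpha> c x [r, s] * \<beta> c x [p, q, u, v]
  - \<alpha> c x [r, u] * \<beta> c x [p, q, s, v] + \<alpha> c x [r, v] * \<beta> c x [p, q, s, u]
  + \<alpha> c x [s, u] * \<beta> c x [p, q, r, v] - \<alpha> c x [s, v] * \<beta> c x [p, q, r, u]
  + \<alpha> c x [u, v] * \<beta> c x [p, q, r, s]"
  by (simp add: wedge_Cons wedge_0 wedge_Nil numeral_eq_Suc algebra_simps)

lemma wedge_4_six: "wedge 4 \<alpha> \<beta> c x [p, q, r, s, u, v] =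
    \<alpha> c x [r, s, u, v] * \<beta> c x [p, q] - \<alpha> c x [q, s, u, v] * \<beta> c x [p, r]
  + \<alpha> c x [q, r, u, v] * \<beta> c x [p, s] - \<alpha> c x [q, r, s, v] * \<beta> c x [p, u]
  + \<alpha> c x [q, r, s, u] * \<beta> c x [p, v] + \<alpha> c x [p, s, u, v] * \<beta> c x [q, r]
  - \<alpha> c x [p, r, u, v] * \<beta> c x [q, s] + \<alpha> c x [p, r, s, v] * \<beta> c x [q, u]
  - \<alpha> c x [p, r, s, u] * \<beta> c x [q, v] + \<alpha> c x [p, q, u, v] * \<beta> c x [r, s]
  - \<alpha> c x [p, q, s, v] * \<beta> c x [r, u] + \<alpha> c x [p, q, s, u] * \<beta> c x [r, v]
  + \<alpha> c x [p, q, r, v] * \<beta> c x [s, u] - \<alpha> c x [p, q, r, u] * \<beta> c x [s, v]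
  + \<alpha> c x [p, q, r, s] * \<beta> c x [u, v]"
  by (simp add: wedge_Cons wedge_0 wedge_Nil numeral_eq_Suc algebra_simps)

section \<open>Calculus on open sets\<close>

text \<open>Coordinate expressions mean something only on the chart image, so identities between
  them pass to derivatives only through its openness.\<close>

lemma frechet_derivative_cong_open:
  assumes "open S" "x \<in> S" "\<And>y. y \<in> S \<Longrightarrow> f y = h y"
  shows "frechet_derivative f (at x) = frechet_derivative h (at x)"
proof -
  have "(f has_derivative f') (at x) \<longleftrightarrow> (h has_derivative f') (at x)" for f'
    using has_derivative_transform_within_open[OF _ assms(1,2), of f f' UNIV h]
      has_derivative_transform_within_open[OF _ assms(1,2), of h f' UNIV f] assms(3) by auto
  then show ?thesis by (simp add: frechet_derivative_def)
qed

lemma differentiable_on_cong_open: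
  assumes "open S" "\<And>y. y \<in> S \<Longrightarrow> f y = h y" "f differentiable_on S"
  shows "h differentiable_on S"
proof -
  have "(h has_derivative f') (at x within S)"
    if "x \<in> S" "(f has_derivative f') (at x within S)" for x f'
    by (rule has_derivative_transform[OF that(1) _ that(2)]) (simp add: assms(2))
  then show ?thesis using assms(3) unfolding differentiable_on_def differentiable_def by blast
qed

lemma Ck_on_cong:
  assumes "open S" "\<And>y. y \<in> S \<Longrightarrow> f y = h y" "Ck_on n S f"
  shows "Ck_on n S h"
  using assms(2,3)
proof (induction n arbitrary: f h)
  case 0
  then show ?case using continuous_on_cong[of S S f h] by simp
next
  case (Suc n)
  have "frechet_derivative f (at y) v = frechet_derivative h (at y) v" if "y \<in> S" for y v
    using frechet_derivative_cong_open[OF assms(1) that Suc.prems(1)] by simp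
  then have "Ck_on n S (\<lambda>y. frechet_derivative h (at y) v)" for v
    by (rule Suc.IH) (use Suc.prems in auto)
  then show ?case
    using differentiable_on_cong_open[OF assms(1) Suc.prems(1)] Suc.prems(2) by simp
qed

lemma Ck_on_SucD: "Ck_on (Suc n) S f \<Longrightarrow> Ck_on n S f"
proof (induction n arbitrary: f)
  case 0
  then show ?case by (simp add: differentiable_imp_continuous_on)
next
  case (Suc n)
  from Suc.prems have "Ck_on n S (\<lambda>x. frechet_derivative f (at x) v)" for v
    by (intro Suc.IH) simp
  then show ?case using Suc.prems by simp
qed

lemma Ck_on_has_derivative:
  "open S \<Longrightarrow> Ck_on (Suc n) S f \<Longrightarrow> x \<in> S \<Longrightarrow> (f has_derivative frechet_derivative f (at x)) (at x)"
  by (simp add: differentiable_on_eq_differentiable_at frechet_derivative_works)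

lemma Ck_on_SucI:
  assumes "open S" "\<And>x. x \<in> S \<Longrightarrow> (f has_derivative D x) (at x)"
    and "\<And>v. Ck_on n S (\<lambda>x. D x v)"
  shows "Ck_on (Suc n) S f"
proof -
  have "frechet_derivative f (at x) = D x" if "x \<in> S" for x
    using frechet_derivative_at[OF assms(2)[OF that]] by simp
  then have "Ck_on n S (\<lambda>x. frechet_derivative f (at x) v)" for v
    by (intro Ck_on_cong[OF assms(1) _ assms(3)[of v]]) simp
  moreover have "f differentiable_on S"
    using assms(2) by (auto simp: differentiable_on_eq_differentiable_at[OF assms(1)] differentiable_def)
  ultimately show ?thesis by simp
qed

lemma Ck_on_const: "Ck_on n S (\<lambda>x. c)"
  by (induction n arbitrary: c) (simp_all add: frechet_derivative_const)

lemma Ck_on_bounded_linear: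
  assumes "open S" "bounded_linear h" "Ck_on n S f" shows "Ck_on n S (\<lambda>x. h (f x))"
  using assms(3)
proof (induction n arbitrary: f)
  case 0
  then show ?case using bounded_linear.continuous_on[OF assms(2)] by simp
next
  case (Suc n)
  show ?case
  proof (rule Ck_on_SucI[OF assms(1)])
    show "((\<lambda>x. h (f x)) has_derivative (\<lambda>v. h (frechet_derivative f (at x) v))) (at x)"
      if "x \<in> S" for x
      using bounded_linear.has_derivative[OF assms(2) Ck_on_has_derivative[OF assms(1) Suc.prems that]] .
    show "Ck_on n S (\<lambda>x. h (frechet_derivative f (at x) v))" for v
      by (rule Suc.IH) (use Suc.prems in simp)
  qed
qed

lemma Ck_on_add:
  assumes "open S" "Ck_on n S f" "Ck_on n S h" shows "Ck_on n S (\<lambda>x. f x + h x)"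
  using assms(2,3)
proof (induction n arbitrary: f h)
  case 0
  then show ?case by (simp add: continuous_on_add)
next
  case (Suc n)
  show ?case
  proof (rule Ck_on_SucI[OF assms(1)])
    show "((\<lambda>x. f x + h x) has_derivative
        (\<lambda>v. frechet_derivative f (at x) v + frechet_derivative h (at x) v)) (at x)"
      if "x \<in> S" for x
      by (intro has_derivative_add Ck_on_has_derivative[where n = n, OF assms(1) _ that] Suc.prems)
    show "Ck_on n S (\<lambda>x. frechet_derivative f (at x) v + frechet_derivative h (at x) v)" for v
      by (rule Suc.IH) (use Suc.prems in simp_all)
  qed
qed

lemma Ck_on_scaleR:
  fixes f :: "'a::euclidean_space \<Rightarrow> real"
  assumes "open S" "Ck_on n S f" "Ck_on n S h" shows "Ck_on n S (\<lambda>x. f x *\<^sub>R h x)"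
  using assms(2,3)
proof (induction n arbitrary: f h)
  case 0
  then show ?case by (simp add: continuous_on_scaleR)
next
  case (Suc n)
  show ?case
  proof (rule Ck_on_SucI[OF assms(1)])
    show "((\<lambda>x. f x *\<^sub>R h x) has_derivative
        (\<lambda>v. f x *\<^sub>R frechet_derivative h (at x) v + frechet_derivative f (at x) v *\<^sub>R h x)) (at x)"
      if "x \<in> S" for x
      by (intro has_derivative_scaleR Ck_on_has_derivative[where n = n, OF assms(1) _ that] Suc.prems)
    show "Ck_on n S (\<lambda>x. f x *\<^sub>R frechet_derivative h (at x) v
        + frechet_derivative f (at x) v *\<^sub>R h x)" for v
      \<comment> \<open>The product rule keeps one factor undifferentiated, and that factor is
        needed one order lower.\<close>
      using Ck_on_SucD[OF Suc.prems(1)] Ck_on_SucD[OF Suc.prems(2)] Suc.prems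
      by (intro Ck_on_add[OF assms(1)] Suc.IH) simp_all
  qed
qed

lemma Ck_on_sum:
  assumes "open S" "finite I" "\<And>i. i \<in> I \<Longrightarrow> Ck_on n S (f i)"
  shows "Ck_on n S (\<lambda>x. \<Sum>i\<in>I. f i x)"
  using assms(2,3) by (induction I) (simp_all add: Ck_on_const Ck_on_add[OF assms(1)])

lemma smooth_on_differentiable:
  assumes "open S" "smooth_on S f" "x \<in> S"
  shows "f differentiable (at x)" "(\<lambda>y. frechet_derivative f (at y) v) differentiable (at x)"
proof -
  have "Ck_on (Suc (Suc 0)) S f" using assms(2) by (auto simp: smooth_on_def)
  then show "f differentiable (at x)" "(\<lambda>y. frechet_derivative f (at y) v) differentiable (at x)"
    using assms(1,3) by (auto simp: differentiable_on_eq_differentiable_at)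
qed

section \<open>Fields of linear maps evaluated at vector fields\<close>

lemma linear_apply_basis:
  fixes L :: "'b::euclidean_space \<Rightarrow> 'c::real_vector"
  assumes "linear L" shows "L v = (\<Sum>b\<in>Basis. (v \<bullet> b) *\<^sub>R L b)"
proof -
  have "L v = L (\<Sum>b\<in>Basis. (v \<bullet> b) *\<^sub>R b)" by (simp add: euclidean_representation)
  then show ?thesis by (simp add: linear_sum[OF assms] linear_cmul[OF assms])
qed

text \<open>The metric is known to be smooth for constant arguments only. Expanding a varying
  argument in the standard basis reduces it to those.\<close>

lemma smooth_on_apply_linear:
  fixes L :: "'a::euclidean_space \<Rightarrow> 'b::euclidean_space \<Rightarrow> 'c::real_normed_vector"
  assumes S: "open S" and lin: "\<And>y. y \<in> S \<Longrightarrow> linear (L y)"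
    and L: "\<And>v. smooth_on S (\<lambda>y. L y v)" and X: "smooth_on S X"
  shows "smooth_on S (\<lambda>y. L y (X y))"
  unfolding smooth_on_def
proof
  fix n
  have "Ck_on n S (\<lambda>y. \<Sum>b\<in>Basis. (X y \<bullet> b) *\<^sub>R L y b)"
    using L X unfolding smooth_on_def
    by (intro Ck_on_sum S Ck_on_scaleR Ck_on_bounded_linear[OF S bounded_linear_inner_left]) auto
  then show "Ck_on n S (\<lambda>y. L y (X y))"
    by (rule Ck_on_cong[OF S, rotated]) (simp add: linear_apply_basis[OF lin, symmetric])
qed

lemma has_derivative_apply_linear:
  fixes L :: "'a::euclidean_space \<Rightarrow> 'b::euclidean_space \<Rightarrow> 'c::real_normed_vector"
  assumes S: "open S" "x \<in> S" and lin: "\<And>y. y \<in> S \<Longrightarrow> linear (L y)"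
    and L: "\<And>v. (\<lambda>y. L y v) differentiable (at x)" and X: "X differentiable (at x)"
  shows "((\<lambda>y. L y (X y)) has_derivative (\<lambda>u. frechet_derivative (\<lambda>y. L y (X x)) (at x) u
           + L x (frechet_derivative X (at x) u))) (at x)"
proof -
  note DL = L[unfolded frechet_derivative_works] and DX = X[unfolded frechet_derivative_works]
  let ?D = "\<lambda>v. frechet_derivative (\<lambda>y. L y v) (at x)" and ?X = "frechet_derivative X (at x)"
  have "((\<lambda>y. \<Sum>b\<in>Basis. (v \<bullet> b) *\<^sub>R L y b) has_derivative
      (\<lambda>u. \<Sum>b\<in>Basis. (v \<bullet> b) *\<^sub>R ?D b u)) (at x)" for v
    by (intro has_derivative_sum has_derivative_scaleR_right DL)
  then have "((\<lambda>y. L y v) has_derivative (\<lambda>u. \<Sum>b\<in>Basis. (v \<bullet> b) *\<^sub>R ?D b u)) (at x)" for v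
    by (rule has_derivative_transform_within_open[OF _ S])
      (simp add: linear_apply_basis[OF lin, symmetric])
  \<comment> \<open>The derivative at a frozen vector is linear in that vector, so the basis sum can
    be folded back at \<open>X x\<close>.\<close>
  from frechet_derivative_at[OF this, symmetric]
  have D: "?D v = (\<lambda>u. \<Sum>b\<in>Basis. (v \<bullet> b) *\<^sub>R ?D b u)" for v .
  have "((\<lambda>y. \<Sum>b\<in>Basis. (X y \<bullet> b) *\<^sub>R L y b) has_derivative
      (\<lambda>u. \<Sum>b\<in>Basis. (X x \<bullet> b) *\<^sub>R ?D b u + (?X u \<bullet> b) *\<^sub>R L x b)) (at x)"
    by (intro has_derivative_sum has_derivative_scaleR DL has_derivative_inner_left DX)
  then have "((\<lambda>y. L y (X y)) has_derivative
      (\<lambda>u. \<Sum>b\<in>Basis. (X x \<bullet> b) *\<^sub>R ?D b u + (?X u \<bullet> b) *\<^sub>R L x b)) (at x)"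
    by (rule has_derivative_transform_within_open[OF _ S])
      (simp add: linear_apply_basis[OF lin, symmetric])
  also have "(\<lambda>u. \<Sum>b\<in>Basis. (X x \<bullet> b) *\<^sub>R ?D b u + (?X u \<bullet> b) *\<^sub>R L x b)
      = (\<lambda>u. ?D (X x) u + L x (?X u))"
    unfolding D[of "X x"]
    by (simp add: sum.distrib linear_apply_basis[OF lin[OF S(2)], symmetric])
  finally show ?thesis .
qed

lemma frechet_derivative_eqI: "(f has_derivative f') (at x) \<Longrightarrow> frechet_derivative f (at x) u = f' u"
  by (metis frechet_derivative_at)

lemma linear_functional_eqI:
  assumes "linear f" "linear h" "\<And>i. f (axis i 1) = h (axis i (1::real))"
  shows "f = (h :: real^'n \<Rightarrow> real)"
  by (rule linear_eq_stdbasis[OF assms(1,2)]) (auto simp: Basis_vec_def assms(3))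

lemma differentiable_prod:
  fixes f :: "'i \<Rightarrow> 'b::real_normed_vector \<Rightarrow> real"
  assumes "finite I" "\<And>i. i \<in> I \<Longrightarrow> f i differentiable (at x)"
  shows "(\<lambda>y. \<Prod>i\<in>I. f i y) differentiable (at x)"
  using assms by (induction I) auto

lemma differentiable_det:
  fixes M :: "'b::real_normed_vector \<Rightarrow> real^'n^'n"
  assumes "\<And>i j. (\<lambda>y. M y $ i $ j) differentiable (at x)"
  shows "(\<lambda>y. det (M y)) differentiable (at x)"
  unfolding det_def
  by (intro differentiable_sum differentiable_mult differentiable_const ballI
      differentiable_prod[where f = "\<lambda>i y. M y $ i $ _ i"] assms) auto

lemma differentiable_vec:
  fixes f :: "'b::real_normed_vector \<Rightarrow> real^'n"
  assumes "\<And>k. (\<lambda>y. f y $ k) differentiable (at x)"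
  shows "f differentiable (at x)"
  by (subst differentiable_componentwise_within) (auto simp: Basis_vec_def inner_axis assms)

lemma differentiable_cong_open:
  assumes "f differentiable (at x)" "open T" "x \<in> T" "\<And>y. y \<in> T \<Longrightarrow> f y = h y"
  shows "h differentiable (at x)"
  using assms has_derivative_transform_within_open unfolding differentiable_def by blast

section \<open>The Levi-Civita connection in a chart\<close>

locale three_sasakian_chart =
  fixes \<A> :: "'a::topological_space chart set" and g :: "'a metric"
    and \<xi> :: "3 \<Rightarrow> 'a vfield" and c :: "'a chart"
  assumes ts: "three_sasakian \<A> g \<xi>" and c: "c \<in> \<A>"
begin

abbreviation "S \<equiv> chart_img c"
abbreviation "Dg y u v w \<equiv> frechet_derivative (\<lambda>y. g c y u v) (at y) w"
abbreviation "\<Gamma> \<equiv> christoffel g c"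
abbreviation "D\<xi> i y \<equiv> frechet_derivative (\<xi> i c) (at y)"
abbreviation "N i \<equiv> nabla g (\<xi> i) c"

lemma open_S: "open S"
  using ts c by (simp add: three_sasakian_def smooth_atlas_def)

lemma metric: "riemannian_metric \<A> g"
  using ts by (simp add: three_sasakian_def)

lemma g_bilinear: "y \<in> S \<Longrightarrow> bilinear (g c y)"
  and g_sym: "y \<in> S \<Longrightarrow> g c y u v = g c y v u"
  and g_pos: "y \<in> S \<Longrightarrow> u \<noteq> 0 \<Longrightarrow> g c y u u > 0"
  and g_smooth: "smooth_on S (\<lambda>y. g c y u v)"
  using metric c by (auto simp: riemannian_metric_def)

lemma g_linear: "y \<in> S \<Longrightarrow> linear (g c y u)" "y \<in> S \<Longrightarrow> linear (\<lambda>u. g c y u v)"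
  using g_bilinear by (auto simp: bilinear_def)

lemmas g_simps =
  linear_add[OF g_linear(1)] linear_add[OF g_linear(2)]
  linear_diff[OF g_linear(1)] linear_diff[OF g_linear(2)]
  linear_neg[OF g_linear(1)] linear_neg[OF g_linear(2)]
  linear_cmul[OF g_linear(1)] linear_cmul[OF g_linear(2)]
  linear_0[OF g_linear(1)] linear_0[OF g_linear(2)]

lemma g_eqI:
  assumes y: "y \<in> S" and "\<And>z. g c y w z = g c y w' z" shows "w = w'"
proof -
  have "g c y (w - w') (w - w') = 0" using assms by (simp add: g_simps)
  then show ?thesis using g_pos[OF y, of "w - w'"] by force
qed

lemma \<xi>_field: "vector_field \<A> (\<xi> i)"
  using ts by (simp add: three_sasakian_def killing_field_def)

lemma \<xi>_smooth: "smooth_on S (\<xi> i c)"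
  using \<xi>_field c by (simp add: vector_field_def)

lemma \<xi>_orthonormal: "y \<in> S \<Longrightarrow> g c y (\<xi> i c y) (\<xi> j c y) = (if i = j then 1 else 0)"
  using ts c by (simp add: three_sasakian_def)

lemma bracket: "y \<in> S \<Longrightarrow> lie_bracket (\<xi> i) (\<xi> (i + 1)) c y = 2 *\<^sub>R \<xi> (i + 2) c y"
  using ts c by (simp add: three_sasakian_def)

lemma killing:
  "y \<in> S \<Longrightarrow> Dg y u v (\<xi> i c y) + g c y (D\<xi> i y u) v + g c y u (D\<xi> i y v) = 0"
  using ts c by (simp add: three_sasakian_def killing_field_def)

lemma sasakian:
  "y \<in> S \<Longrightarrow> nabla_endo g (\<lambda>c x w. - nabla g (\<xi> i) c x w) c y u v
     = g c y u v *\<^sub>R \<xi> i c y - g c y (\<xi> i c y) v *\<^sub>R u"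
  using ts c by (simp add: three_sasakian_def sasakian_field_def)

lemma g_differentiable: "y \<in> S \<Longrightarrow> (\<lambda>y. g c y u v) differentiable (at y)"
  and Dg_differentiable: "y \<in> S \<Longrightarrow> (\<lambda>y. Dg y u v w) differentiable (at y)"
  and \<xi>_differentiable: "y \<in> S \<Longrightarrow> \<xi> i c differentiable (at y)"
  and D\<xi>_differentiable: "y \<in> S \<Longrightarrow> (\<lambda>y. D\<xi> i y u) differentiable (at y)"
  using smooth_on_differentiable[OF open_S g_smooth] smooth_on_differentiable[OF open_S \<xi>_smooth]
  by blast+

lemma D\<xi>_linear: "y \<in> S \<Longrightarrow> linear (D\<xi> i y)"
  by (simp add: \<xi>_differentiable linear_frechet_derivative)

lemma Dg_linear: "y \<in> S \<Longrightarrow> linear (Dg y u v)"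
  by (simp add: g_differentiable linear_frechet_derivative)

lemma Dg_sym: "y \<in> S \<Longrightarrow> Dg y u v w = Dg y v u w"
  using frechet_derivative_cong_open[OF open_S, of y "\<lambda>y. g c y u v" "\<lambda>y. g c y v u"] g_sym
  by simp

lemma Dg_linear2:
  assumes y: "y \<in> S" shows "linear (\<lambda>v. Dg y u v w)"
proof (rule linearI)
  note D = g_differentiable[OF y, unfolded frechet_derivative_works]
  fix v v' r
  have "((\<lambda>y. g c y u (v + v')) has_derivative (\<lambda>w. Dg y u v w + Dg y u v' w)) (at y)"
    by (rule has_derivative_transform_within_open[OF has_derivative_add[OF D D] open_S y])
      (simp add: g_simps)
  then show "Dg y u (v + v') w = Dg y u v w + Dg y u v' w"
    by (rule frechet_derivative_eqI)
  have "((\<lambda>y. g c y u (r *\<^sub>R v)) has_derivative (\<lambda>w. r *\<^sub>R Dg y u v w)) (at y)"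
    by (rule has_derivative_transform_within_open[OF has_derivative_scaleR_right[OF D] open_S y])
      (simp add: g_simps)
  then show "Dg y u (r *\<^sub>R v) w = r *\<^sub>R Dg y u v w"
    by (rule frechet_derivative_eqI)
qed

lemma Dg_linear1: "y \<in> S \<Longrightarrow> linear (\<lambda>u. Dg y u v w)"
  using Dg_linear2[of y v w] by (simp add: Dg_sym[of y _ v])

lemmas Dg_simps =
  linear_add[OF Dg_linear] linear_add[OF Dg_linear1] linear_add[OF Dg_linear2]
  linear_cmul[OF Dg_linear] linear_cmul[OF Dg_linear1] linear_cmul[OF Dg_linear2]

definition koszul where "koszul y u v z = Dg y v z u + Dg y u z v - Dg y u v z"

lemma koszul_linear: "y \<in> S \<Longrightarrow> linear (koszul y u v)" "y \<in> S \<Longrightarrow> linear (\<lambda>v. koszul y u v z)"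
  by (auto intro!: linearI simp: koszul_def Dg_simps algebra_simps)

text \<open>Rows belong to the test vector and columns to the coordinates of the unknown
  \<open>w\<close> in the Koszul equation \<open>2 * g c y w z = koszul y u v z\<close>.\<close>

definition gram :: "real^7 \<Rightarrow> real^7^7" where
  "gram y = (\<chi> i j. 2 * g c y (axis j 1) (axis i 1))"

text \<open>The definite description of the Christoffel symbols says nothing about their dependence
  on the point. As quotients of determinants with differentiable entries they exist, are unique and
  are differentiable, all at once.\<close>

definition cramer_sol :: "real^7 \<Rightarrow> real^7 \<Rightarrow> real^7 \<Rightarrow> real^7" where
  "cramer_sol y u v = (\<chi> k. det (\<chi> i j. if j = k then koszul y u v (axis i 1) else gram y $ i $ j)
     / det (gram y))"

lemma gram_mult:
  assumes y: "y \<in> S" shows "gram y *v w = (\<chi> i. 2 * g c y w (axis i 1))"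
proof -
  have "2 * g c y w (axis i 1) = (\<Sum>j\<in>UNIV. 2 * g c y (axis j 1) (axis i 1) * w $ j)" for i
  proof -
    have "g c y w (axis i 1) = g c y (\<Sum>j\<in>UNIV. w $ j *\<^sub>R axis j 1) (axis i 1)"
      using basis_expansion[of w] by (simp add: scalar_mult_eq_scaleR)
    also have "\<dots> = (\<Sum>j\<in>UNIV. w $ j * g c y (axis j 1) (axis i 1))"
      by (simp add: linear_sum[OF g_linear(2)[OF y]] linear_cmul[OF g_linear(2)[OF y]])
    finally show ?thesis by (simp add: sum_distrib_left mult.commute mult.left_commute)
  qed
  then show ?thesis by (simp add: gram_def matrix_vector_mult_def vec_eq_iff)
qed

lemma det_gram:
  assumes y: "y \<in> S" shows "det (gram y) \<noteq> 0"
proof -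
  have "w = 0" if "gram y *v w = 0" for w
  proof (rule g_eqI[OF y])
    fix z
    have "g c y w = (\<lambda>z. 0)"
      by (rule linear_functional_eqI) (use that y in \<open>auto simp: gram_mult vec_eq_iff g_linear module_hom_zero\<close>)
    then show "g c y w z = g c y 0 z" using y by (simp add: g_simps)
  qed
  then show ?thesis
    by (metis invertible_det_nz invertible_left_inverse matrix_left_invertible_ker)
qed

lemma koszul_iff:
  assumes y: "y \<in> S"
  shows "(\<forall>z. 2 * g c y w z = koszul y u v z) \<longleftrightarrow> w = cramer_sol y u v"
proof -
  have "(\<forall>z. 2 * g c y w z = koszul y u v z) \<longleftrightarrow> (\<forall>i. 2 * g c y w (axis i 1) = koszul y u v (axis i 1))"
  proof safe
    fix z assume "\<forall>i. 2 * g c y w (axis i 1) = koszul y u v (axis i 1)"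
    then have "(\<lambda>z. 2 * g c y w z) = koszul y u v"
      by (intro linear_functional_eqI koszul_linear y)
        (auto intro!: linearI simp: g_simps y algebra_simps)
    then show "2 * g c y w z = koszul y u v z" by metis
  qed simp
  also have "\<dots> \<longleftrightarrow> gram y *v w = (\<chi> i. koszul y u v (axis i 1))"
    by (simp add: gram_mult[OF y] vec_eq_iff)
  also have "\<dots> \<longleftrightarrow> w = cramer_sol y u v"
    unfolding cramer_sol_def cramer[OF det_gram[OF y]] by (simp cong: if_cong)
  finally show ?thesis .
qed

lemma christoffel_cramer: "y \<in> S \<Longrightarrow> \<Gamma> y u v = cramer_sol y u v"
  unfolding christoffel_def koszul_iff[unfolded koszul_def] by simp

lemma g_christoffel: "y \<in> S \<Longrightarrow> g c y (\<Gamma> y u v) z = koszul y u v z / 2"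
  using koszul_iff[of y "\<Gamma> y u v" u v] christoffel_cramer by (simp add: field_simps)

lemma christoffel_sym: "y \<in> S \<Longrightarrow> \<Gamma> y u v = \<Gamma> y v u"
  by (rule g_eqI) (auto simp: g_christoffel koszul_def Dg_sym)

lemma christoffel_linear: "y \<in> S \<Longrightarrow> linear (\<Gamma> y u)" "y \<in> S \<Longrightarrow> linear (\<lambda>u. \<Gamma> y u v)"
proof -
  show *: "linear (\<Gamma> y u)" if y: "y \<in> S" for u
    by (intro linearI g_eqI[OF y])
      (simp_all add: g_christoffel y g_simps linear_add[OF koszul_linear(2)] linear_cmul[OF koszul_linear(2)]
        add_divide_distrib)
  show "linear (\<lambda>u. \<Gamma> y u v)" if "y \<in> S"
    using *[OF that, of v] by (simp add: christoffel_sym[OF that, of _ v])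
qed

lemma christoffel_differentiable:
  assumes x: "x \<in> S" shows "(\<lambda>y. \<Gamma> y u v) differentiable (at x)"
proof (rule differentiable_cong_open[OF _ open_S x christoffel_cramer[symmetric]])
  have K: "(\<lambda>y. koszul y u v z) differentiable (at x)" for z
    unfolding koszul_def by (intro differentiable_add differentiable_diff Dg_differentiable x)
  have G: "(\<lambda>y. gram y $ i $ j) differentiable (at x)" for i j
    unfolding gram_def vec_lambda_beta
    by (intro differentiable_mult differentiable_const g_differentiable x)
  have "(\<lambda>y. det (\<chi> i j. if j = k then koszul y u v (axis i 1) else gram y $ i $ j) / det (gram y))
      differentiable (at x)" for k
  proof (intro differentiable_divide differentiable_det det_gram x)
    show "(\<lambda>y. (\<chi> i j. if j = k then koszul y u v (axis i 1) else gram y $ i $ j) $ i $ j)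
        differentiable (at x)" for i j
      by (cases "j = k") (simp_all add: K G)
  qed (rule G)
  then show "(\<lambda>y. cramer_sol y u v) differentiable (at x)"
    by (intro differentiable_vec) (simp add: cramer_sol_def)
qed

lemma nabla_linear: "y \<in> S \<Longrightarrow> linear (N i y)"
  unfolding nabla_def by (intro linear_compose_add D\<xi>_linear christoffel_linear)

lemma nabla_differentiable:
  assumes x: "x \<in> S" shows "(\<lambda>y. N i y u) differentiable (at x)"
proof -
  have "(\<lambda>y. \<Gamma> y u (\<xi> i c y)) differentiable (at x)"
    using has_derivative_apply_linear[OF open_S x christoffel_linear(1) christoffel_differentiable[OF x]
        \<xi>_differentiable[OF x]] by (auto simp: differentiable_def)
  then show ?thesis
    unfolding nabla_def by (intro differentiable_add D\<xi>_differentiable x)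
qed

section \<open>Covariant derivatives of the Killing fields\<close>

lemma has_derivative_g\<xi>:
  assumes x: "x \<in> S"
  shows "((\<lambda>y. g c y (\<xi> i c y) v) has_derivative
    (\<lambda>u. Dg x (\<xi> i c x) v u + g c x (D\<xi> i x u) v)) (at x)"
  by (rule has_derivative_apply_linear[OF open_S x g_linear(2) g_differentiable[OF x] \<xi>_differentiable[OF x]])

text \<open>The constant inner products of the fields are differentiated. By the Koszul formula the
  two Christoffel terms add up to the derivative of the metric.\<close>

lemma nabla_compatible:
  assumes x: "x \<in> S"
  shows "g c x (N i x u) (\<xi> j c x) + g c x (\<xi> i c x) (N j x u) = 0"
proof -
  have "((\<lambda>y. g c y (\<xi> i c y) (\<xi> j c y)) has_derivative
      (\<lambda>u. frechet_derivative (\<lambda>y. g c y (\<xi> i c y) (\<xi> j c x)) (at x) u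
         + g c x (\<xi> i c x) (D\<xi> j x u))) (at x)"
    by (rule has_derivative_apply_linear[OF open_S x g_linear(1) _ \<xi>_differentiable[OF x]])
      (use has_derivative_g\<xi>[OF x] in \<open>auto simp: differentiable_def\<close>)
  moreover have "((\<lambda>y. g c y (\<xi> i c y) (\<xi> j c y)) has_derivative (\<lambda>u. 0)) (at x)"
    by (rule has_derivative_transform_within_open[OF _ open_S x, of "\<lambda>y. if i = j then 1 else 0"])
      (auto simp: \<xi>_orthonormal)
  ultimately have "frechet_derivative (\<lambda>y. g c y (\<xi> i c y) (\<xi> j c x)) (at x) u
         + g c x (\<xi> i c x) (D\<xi> j x u) = 0"
    by (rule fun_cong[OF has_derivative_unique])
  then have "Dg x (\<xi> i c x) (\<xi> j c x) u + g c x (D\<xi> i x u) (\<xi> j c x)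
      + g c x (\<xi> i c x) (D\<xi> j x u) = 0"
    by (simp add: frechet_derivative_eqI[OF has_derivative_g\<xi>[OF x]])
  then show ?thesis
    using x g_sym[of x "\<xi> i c x" "\<Gamma> x u (\<xi> j c x)"] Dg_sym[of x "\<xi> j c x" "\<xi> i c x"]
    by (simp add: nabla_def g_simps g_christoffel koszul_def field_simps)
qed

text \<open>Symmetrized in \<open>u\<close> and \<open>v\<close>, the Christoffel terms contribute
  exactly the derivative of the metric along \<open>\<xi> i\<close>, so the Killing equation becomes
  skewness.\<close>

lemma nabla_skew:
  assumes x: "x \<in> S" shows "g c x (N i x u) v = - g c x (N i x v) u"
  using killing[OF x, of u v i] g_sym[OF x, of u "D\<xi> i x v"]
  by (simp add: x nabla_def g_simps g_christoffel koszul_def Dg_sym[of x "\<xi> i c x"] Dg_sym[of x u v] field_simps)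

lemma ext_deriv_eta:
  assumes x: "x \<in> S" shows "ext_deriv (eta g \<xi> i) c x [u, v] = 2 * g c x (N i x u) v"
  using killing[OF x, of u v i] g_sym[OF x, of u "D\<xi> i x v"]
  by (simp add: x ext_deriv_def eta_def nabla_def g_simps g_christoffel koszul_def
      frechet_derivative_eqI[OF has_derivative_g\<xi>[OF x]]
      Dg_sym[of x "\<xi> i c x" u] Dg_sym[of x "\<xi> i c x" v] field_simps)

text \<open>Skewness of both endomorphisms and \<open>nabla_compatible\<close> carry the fields
  across the metric. The symmetric part of the covariant derivatives among the fields is therefore
  zero, and the brackets determine the rest.\<close>

lemma nabla_\<xi>_swap:
  assumes x: "x \<in> S" shows "N i x (\<xi> j c x) = - N j x (\<xi> i c x)"
proof (rule g_eqI[OF x])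
  fix z
  show "g c x (N i x (\<xi> j c x)) z = g c x (- N j x (\<xi> i c x)) z"
    using nabla_compatible[OF x, of i z j] nabla_skew[OF x, of i z "\<xi> j c x"]
      nabla_skew[OF x, of j z "\<xi> i c x"] g_sym[OF x, of "\<xi> i c x" "N j x z"]
    by (simp add: x g_simps)
qed

lemma nabla_\<xi>_self: "x \<in> S \<Longrightarrow> N i x (\<xi> i c x) = 0"
  using nabla_\<xi>_swap[of x i i] by (metis eq_neg_iff_add_eq_0 scaleR_2 scaleR_eq_0_iff zero_neq_numeral)

lemma nabla_\<xi>:
  assumes x: "x \<in> S"
  shows "N (i + 1) x (\<xi> i c x) = \<xi> (i + 2) c x" "N i x (\<xi> (i + 1) c x) = - \<xi> (i + 2) c x"
proof -
  \<comment> \<open>Torsion-freeness. By the previous antisymmetry this difference is twice its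
    first term, which cancels the 2 in the bracket relation.\<close>
  have "N (i + 1) x (\<xi> i c x) - N i x (\<xi> (i + 1) c x) = lie_bracket (\<xi> i) (\<xi> (i + 1)) c x"
    using christoffel_sym[OF x] by (simp add: nabla_def lie_bracket_def)
  then have "2 *\<^sub>R N (i + 1) x (\<xi> i c x) = 2 *\<^sub>R \<xi> (i + 2) c x"
    using nabla_\<xi>_swap[OF x, of i "i + 1"] bracket[OF x] by (simp add: scaleR_2)
  then show "N (i + 1) x (\<xi> i c x) = \<xi> (i + 2) c x" by simp
  then show "N i x (\<xi> (i + 1) c x) = - \<xi> (i + 2) c x"
    using nabla_\<xi>_swap[OF x, of i "i + 1"] by simp
qed

text \<open>The Sasakian identity at the vertical vector \<open>\<xi> j\<close>: since \<open>\<nabla>\<xi>\<^sub>i\<close> maps \<open>\<xi>\<^sub>j\<close> to a known field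
  \<open>Q\<close>, the Leibniz rule turns \<open>\<nabla>(\<nabla>\<xi>\<^sub>i)\<close> into the composition of the two endomorphisms.\<close>
lemma nabla_comp:
  assumes x: "x \<in> S" and Q: "\<And>y. y \<in> S \<Longrightarrow> N i y (\<xi> j c y) = Q c y"
  shows "N i x (N j x u) = nabla g Q c x u + g c x u (\<xi> j c x) *\<^sub>R \<xi> i c x - (if i = j then u else 0)"
proof -
  let ?v = "\<xi> j c x"
  have "((\<lambda>y. N i y (\<xi> j c y)) has_derivative (\<lambda>u. frechet_derivative (\<lambda>y. N i y ?v) (at x) u
      + N i x (D\<xi> j x u))) (at x)"
    by (rule has_derivative_apply_linear[OF open_S x nabla_linear nabla_differentiable[OF x]
          \<xi>_differentiable[OF x]])
  then have "(Q c has_derivative (\<lambda>u. frechet_derivative (\<lambda>y. N i y ?v) (at x) u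
      + N i x (D\<xi> j x u))) (at x)"
    by (rule has_derivative_transform_within_open[OF _ open_S x]) (rule Q)
  then have DQ: "frechet_derivative (Q c) (at x) u = frechet_derivative (\<lambda>y. N i y ?v) (at x) u
      + N i x (D\<xi> j x u)"
    by (rule frechet_derivative_eqI)
  have neg: "frechet_derivative (\<lambda>y. - N i y ?v) (at x) u = - frechet_derivative (\<lambda>y. N i y ?v) (at x) u"
    by (rule frechet_derivative_eqI[OF has_derivative_minus[OF
          nabla_differentiable[OF x, unfolded frechet_derivative_works]]])
  have "nabla_endo g (\<lambda>c x w. - nabla g (\<xi> i) c x w) c x u ?v
      = - nabla g Q c x u + N i x (N j x u)"
    unfolding nabla_endo_def neg nabla_def[of g Q] nabla_def[of g "\<xi> j"] DQ
    by (simp add: x Q linear_neg[OF christoffel_linear(1)] linear_add[OF nabla_linear])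
  then show ?thesis
    using sasakian[OF x, of i u ?v] \<xi>_orthonormal[OF x, of i j] by (auto simp: algebra_simps)
qed

text \<open>Here \<open>Q = 0\<close>, since \<open>N i\<close> annihilates its own field. On
  horizontal vectors the square is minus the identity.\<close>

lemma nabla_comp_same: "x \<in> S \<Longrightarrow> N i x (N i x u) = g c x u (\<xi> i c x) *\<^sub>R \<xi> i c x - u"
  using nabla_comp[of x i i "\<lambda>c y. 0" u] nabla_\<xi>_self linear_0[OF christoffel_linear(1)]
  by (simp add: nabla_def frechet_derivative_const)

text \<open>On horizontal vectors these are the quaternion relations with the order of the factors
  reversed, so it is the negatives \<open>- N i\<close> that multiply in the usual order.\<close>

lemma nabla_comp_cyclic:
  assumes x: "x \<in> S"
  shows "N (i + 1) x (N i x u) = N (i + 2) x u + g c x u (\<xi> i c x) *\<^sub>R \<xi> (i + 1) c x"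
    and "N i x (N (i + 1) x u) = - N (i + 2) x u + g c x u (\<xi> (i + 1) c x) *\<^sub>R \<xi> i c x"
proof -
  show "N (i + 1) x (N i x u) = N (i + 2) x u + g c x u (\<xi> i c x) *\<^sub>R \<xi> (i + 1) c x"
    using nabla_comp[OF x, of "i + 1" i "\<xi> (i + 2)" u] nabla_\<xi>(1) by simp
  have "frechet_derivative (\<lambda>y. - \<xi> (i + 2) c y) (at x) u = - D\<xi> (i + 2) x u"
    by (rule frechet_derivative_eqI[OF has_derivative_minus[OF
          \<xi>_differentiable[OF x, unfolded frechet_derivative_works]]])
  then have "nabla g (\<lambda>c y. - \<xi> (i + 2) c y) c x u = - N (i + 2) x u"
    by (simp add: nabla_def linear_neg[OF christoffel_linear(1)[OF x]])
  then show "N i x (N (i + 1) x u) = - N (i + 2) x u + g c x u (\<xi> (i + 1) c x) *\<^sub>R \<xi> i c x"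
    using nabla_comp[OF x, of i "i + 1" "\<lambda>c y. - \<xi> (i + 2) c y" u] nabla_\<xi>(2) by simp
qed

end

section \<open>Adapted frames\<close>

lemma cyclic_3: "(1::3) + 1 = 2" "(1::3) + 2 = 3" "(2::3) + 1 = 3" "(2::3) + 2 = 1"
    "(3::3) + 1 = 1" "(3::3) + 2 = 2"
  by simp_all

context three_sasakian_chart
begin

lemma omega_eq:
  assumes x: "x \<in> S"
  shows "omega g \<xi> i c x [u, v] = - g c x (N i x u) v
    - (g c x (\<xi> (i + 1) c x) u * g c x (\<xi> (i + 2) c x) v
     - g c x (\<xi> (i + 1) c x) v * g c x (\<xi> (i + 2) c x) u)"
  by (simp add: omega_def ext_deriv_eta[OF x] eta2_def wedge_1_pair) (simp add: eta_def field_simps)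

lemma unit_horizontal_exists:
  assumes x: "x \<in> S" shows "\<exists>e. g c x e e = 1 \<and> (\<forall>i. g c x (\<xi> i c x) e = 0)"
proof -
  define f where "f v = (\<chi> i. g c x (\<xi> i c x) v)" for v
  have f: "linear f"
    using x by (auto intro!: linearI simp: f_def vec_eq_iff g_simps)
  have "\<not> inj f"
  proof
    assume "inj f"
    then have "dim (f ` UNIV) = 7" using dim_image_eq[OF f, of UNIV] by (simp add: inj_on_subset)
    then show False using dim_subset_UNIV[of "f ` UNIV"] by simp
  qed
  then obtain v where v: "f v = 0" "v \<noteq> 0" using linear_injective_0[OF f] by blast
  then have h: "g c x (\<xi> i c x) v = 0" for i by (simp add: f_def vec_eq_iff)
  have pos: "g c x v v > 0" using g_pos[OF x v(2)] .
  define e where "e = (1 / sqrt (g c x v v)) *\<^sub>R v"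
  have "g c x e e = 1" "\<And>i. g c x (\<xi> i c x) e = 0"
    using pos by (simp_all add: e_def g_simps x h)
  then show ?thesis by blast
qed

end

locale three_sasakian_frame = three_sasakian_chart +
  fixes x e
  assumes x: "x \<in> S" and e_unit: "g c x e e = 1" and e_hor: "g c x (\<xi> i c x) e = 0"
begin

abbreviation "X i \<equiv> \<xi> i c x"

text \<open>The sign makes e, E_1, E_2, E_3 the images of \<open>e\<close> under 1, I, J, K with IJ
  = K, and gives omega_i the value +1 on (e, E_i).\<close>

definition "E i = - N i x e"

lemma N_neg: "N i x (- u) = - N i x u"
  by (rule linear_neg[OF nabla_linear[OF x]])

lemma N_e: "N i x e = - E i"
  by (simp add: E_def)

lemma N_E: "N i x (E i) = e" "N (i + 1) x (E i) = E (i + 2)" "N i x (E (i + 1)) = - E (i + 2)"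
  using nabla_comp_same[OF x, of i e] nabla_comp_cyclic[OF x, of i e] e_hor g_sym[OF x, of e]
  by (simp_all add: E_def N_neg)

lemmas N_table =
  N_e nabla_\<xi>_self[OF x] N_E(1)
  N_E(2,3)[of 1, unfolded cyclic_3] N_E(2,3)[of 2, unfolded cyclic_3] N_E(2,3)[of 3, unfolded cyclic_3]
  nabla_\<xi>[OF x, of 1, unfolded cyclic_3] nabla_\<xi>[OF x, of 2, unfolded cyclic_3]
  nabla_\<xi>[OF x, of 3, unfolded cyclic_3]

lemma g_e_E: "g c x e (E i) = 0"
  using nabla_skew[OF x, of i e e] g_sym[OF x, of e] x by (simp add: N_e g_simps)

lemma g_X_E: "g c x (X i) (E j) = 0"
proof -
  \<comment> \<open>\<open>N j\<close> maps the vertical space to itself; skewness then makes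
    \<open>E j\<close> orthogonal to it.\<close>
  have "g c x (N j x (X i)) e = 0"
    using e_hor[of 1] e_hor[of 2] e_hor[of 3] exhaust_3[of i] exhaust_3[of j] x
    by (elim disjE) (simp_all add: N_table g_simps)
  then show ?thesis
    using nabla_skew[OF x, of j "X i" e] g_sym[OF x, of "X i" "E j"] x by (simp add: N_e g_simps)
qed

lemma g_E_E: "g c x (E i) (E j) = (if i = j then 1 else 0)"
proof -
  have "g c x (E i) (E j) = - g c x (N i x e) (E j)" by (simp add: E_def g_simps x)
  also have "\<dots> = g c x (N i x (E j)) e" using nabla_skew[OF x, of i e "E j"] by simp
  also have "\<dots> = (if i = j then 1 else 0)"
    using exhaust_3[of i] exhaust_3[of j] g_e_E e_unit g_sym[OF x, of "E _" e] x
    by (elim disjE) (simp_all add: N_table g_simps)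
  finally show ?thesis .
qed

lemmas g_table = \<xi>_orthonormal[OF x] e_unit e_hor g_e_E g_X_E g_E_E
  e_hor[unfolded g_sym[OF x, of _ e]] g_e_E[unfolded g_sym[OF x, of e]] g_X_E[unfolded g_sym[OF x, of "X _"]]

lemma horizontal_frames:
  "horizontal_frame g \<xi> c x [e, E 1, E 2, E 3]" "horizontal_frame g \<xi> c x [- e, E 1, E 2, E 3]"
  using x by (auto simp: horizontal_frame_def less_Suc_eq numeral_eq_Suc g_table g_simps)

text \<open>The only alternative is the value -1. Then reversing \<open>e\<close> gives a positively
  oriented frame, and self-duality of omega_1 in it would equate -1, the value on (-e, E_1), with 1,
  the value on (E_2, E_3).\<close>

lemma pullback_volume_frame:
  assumes "pullback_volume \<A> g \<xi> \<nu>" shows "\<nu> c x [e, E 1, E 2, E 3] = 1"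
proof (rule ccontr)
  assume ne: "\<nu> c x [e, E 1, E 2, E 3] \<noteq> 1"
  have \<nu>: "\<bar>\<nu> c x es\<bar> = 1" "\<nu> c x es = 1 \<Longrightarrow> omega g \<xi> i c x [es ! 0, es ! 1] = omega g \<xi> i c x [es ! 2, es ! 3]"
    if "horizontal_frame g \<xi> c x es" for es i
    using assms c x that unfolding pullback_volume_def by blast+
  have "alternating_form 4 (\<nu> c x)"
    using assms c x by (simp add: pullback_volume_def differential_form_def)
  then have "linear (\<lambda>u. \<nu> c x [u, E 1, E 2, E 3])"
    by (intro skew_form_linear[OF alternating_imp_skew_form[of 4]]) auto
  then have "\<nu> c x [- e, E 1, E 2, E 3] = 1"
    using \<nu>(1)[OF horizontal_frames(1)] ne linear_neg by fastforce
  from \<nu>(2)[OF horizontal_frames(2) this, of 1] x show False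
    by (simp add: omega_eq N_neg N_table g_simps g_table)
qed

definition "frame = [X 1, X 2, X 3, e, E 1, E 2, E 3]"

lemma frame_orthonormal:
  assumes "i < 7" "j < 7" shows "g c x (frame ! i) (frame ! j) = (if i = j then 1 else 0)"
proof -
  have "i \<in> {0, 1, 2, 3, 4, 5, 6}" "j \<in> {0, 1, 2, 3, 4, 5, 6}" using assms by auto
  then show ?thesis
    by (elim insertE emptyE) (simp_all add: frame_def g_table)
qed

lemma frame_distinct: "distinct frame"
  unfolding distinct_conv_nth
proof (intro allI impI notI)
  fix i j assume "i < length frame" "j < length frame" "i \<noteq> j" "frame ! i = frame ! j"
  then show False
    using frame_orthonormal[of i i] frame_orthonormal[of i j] by (simp add: frame_def)
qed

lemma frame_span: "span (set frame) = UNIV"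
proof -
  have orth: "g c x u v = 0" if "u \<in> set frame" "v \<in> set frame" "u \<noteq> v" for u v
    using that by (auto simp: frame_def g_table)
  have unit: "g c x u u = 1" if "u \<in> set frame" for u
    using that by (auto simp: frame_def g_table)
  have "independent (set frame)"
    unfolding independent_explicit_finite_subsets
  proof (intro allI impI ballI)
    fix A f v assume A: "A \<subseteq> set frame" "(\<Sum>v\<in>A. f v *\<^sub>R v) = 0" "v \<in> A"
    have fin: "finite A" using A(1) by (rule finite_subset) simp
    have "0 = g c x (\<Sum>u\<in>A. f u *\<^sub>R u) v" using x by (simp add: A(2) g_simps)
    also have "\<dots> = (\<Sum>u\<in>A. f u * g c x u v)"
      by (simp add: linear_sum[OF g_linear(2)[OF x]] linear_cmul[OF g_linear(2)[OF x]])
    also have "\<dots> = (\<Sum>u\<in>A. if u = v then f v else 0)"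
    proof (rule sum.cong)
      fix u assume "u \<in> A"
      then have "u \<in> set frame" "v \<in> set frame" using A by auto
      then show "f u * g c x u v = (if u = v then f v else 0)" using orth unit by simp
    qed simp
    also have "\<dots> = f v" using fin A(3) by simp
    finally show "f v = 0" by simp
  qed
  moreover have "card (set frame) = 7" using frame_distinct by (simp add: distinct_card frame_def)
  ultimately show ?thesis
    using card_ge_dim_independent[of "set frame" UNIV] by auto
qed

end

section \<open>The deformed instanton form\<close>

text \<open>Naming the left-hand side of the instanton equation allows it to be treated as a single
  skew form of degree 6.\<close>

definition dG2_form where
  "dG2_form \<psi> F = (\<lambda>c x vs. 1/6 * wedge 4 (wedge 2 F F) F c x vs
     + wedge 2 F (\<lambda>c x us. complex_of_real (\<psi> c x us)) c x vs)"

lemma skew_form_dG2_form: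
  assumes "skew_form 2 (F c x)" "skew_form 4 (\<psi> c x)"
  shows "skew_form 6 (dG2_form \<psi> F c x)"
proof -
  have "skew_form (2 + 2) (wedge 2 F F c x)" by (intro skew_form_wedge assms)
  then have "skew_form (4 + 2) (wedge 4 (wedge 2 F F) F c x)"
    by (intro skew_form_wedge assms) simp
  then have w1: "skew_form 6 (wedge 4 (wedge 2 F F) F c x)" by simp
  have "skew_form 4 (\<lambda>vs. complex_of_real (\<psi> c x vs))"
    by (rule skew_form_linear_compose[where L = complex_of_real, OF _ assms(2)]) (simp add: linear_iff scaleR_conv_of_real)
  then have "skew_form (2 + 4) (wedge 2 F (\<lambda>c x us. complex_of_real (\<psi> c x us)) c x)"
    by (intro skew_form_wedge assms)
  then have w2: "skew_form 6 (wedge 2 F (\<lambda>c x us. complex_of_real (\<psi> c x us)) c x)" by simp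
  show ?thesis
    unfolding dG2_form_def by (intro skew_form_add skew_form_mult_left w1 w2)
qed

context three_sasakian_chart
begin

lemma ext_deriv_eta_connection:
  assumes x: "x \<in> S"
  shows "ext_deriv (eta_connection g \<xi> a) c x [u, v]
    = \<i> * complex_of_real (2 * (\<Sum>i\<in>UNIV. a $ i * g c x (N i x u) v))"
proof -
  let ?h = "\<lambda>r. \<i> * complex_of_real r"
  have D: "frechet_derivative (\<lambda>y. eta_connection g \<xi> a c y [v]) (at x) u
     = ?h (\<Sum>i\<in>UNIV. a $ i * frechet_derivative (\<lambda>y. eta g \<xi> i c y [v]) (at x) u)" for u v
  proof (rule frechet_derivative_eqI)
    have "(\<lambda>y. eta g \<xi> i c y [v]) = (\<lambda>y. g c y (\<xi> i c y) v)" for i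
      by (simp add: eta_def)
    then have "(\<lambda>y. eta g \<xi> i c y [v]) differentiable (at x)" for i
      using differentiableI[OF has_derivative_g\<xi>[OF x, of i v]] by simp
    then have "((\<lambda>y. eta g \<xi> i c y [v]) has_derivative
        frechet_derivative (\<lambda>y. eta g \<xi> i c y [v]) (at x)) (at x)" for i
      by (simp only: frechet_derivative_works)
    then show "((\<lambda>y. eta_connection g \<xi> a c y [v]) has_derivative
       (\<lambda>u. ?h (\<Sum>i\<in>UNIV. a $ i * frechet_derivative (\<lambda>y. eta g \<xi> i c y [v]) (at x) u))) (at x)"
      unfolding eta_connection_def
      by (intro has_derivative_mult_right has_derivative_of_real has_derivative_sum)
  qed
  have "ext_deriv (eta_connection g \<xi> a) c x [u, v] =
      ?h (\<Sum>i\<in>UNIV. a $ i * ext_deriv (eta g \<xi> i) c x [u, v])"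
    by (simp add: ext_deriv_def D sum_subtractf right_diff_distrib)
  then show ?thesis
    by (simp add: ext_deriv_eta[OF x] sum_distrib_left mult.left_commute[of _ 2])
qed

lemma skew_form_curvature:
  assumes x: "x \<in> S" shows "skew_form 2 (ext_deriv (eta_connection g \<xi> a) c x)"
proof (rule skew_form_2)
  have "linear (\<lambda>u. g c x (N i x u) v)" for i v
    using linear_compose[OF nabla_linear[OF x] g_linear(2)[OF x]] by (simp add: o_def)
  then have "linear (\<lambda>u. a $ i * g c x (N i x u) v)" for i v
    by (simp add: linear_iff distrib_left)
  then have M: "linear (\<lambda>u. \<Sum>i\<in>UNIV. a $ i * g c x (N i x u) v)" for v
    by (intro linear_compose_sum ballI)
  have "linear (\<lambda>r. \<i> * complex_of_real (2 * r))"
    by (simp add: linear_iff scaleR_conv_of_real algebra_simps)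
  from linear_compose[OF M this]
  show "linear (\<lambda>u. ext_deriv (eta_connection g \<xi> a) c x [u, v])" for v
    unfolding ext_deriv_eta_connection[OF x] o_def .
  show "ext_deriv (eta_connection g \<xi> a) c x [u, v] = - ext_deriv (eta_connection g \<xi> a) c x [v, u]" for u v
    unfolding ext_deriv_eta_connection[OF x] nabla_skew[OF x, of _ u v] by (simp add: sum_negf)
qed

lemma skew_form_psi:
  assumes x: "x \<in> S" and \<nu>: "pullback_volume \<A> g \<xi> \<nu>"
  shows "skew_form 4 (psi g \<xi> \<nu> t \<epsilon> c x)"
proof -
  have "skew_form (Suc 0) (eta g \<xi> i c x)" for i
    by (rule skew_form_1) (simp only: eta_def nth_Cons_0 g_linear(1)[OF x])
  then have eta2: "skew_form 2 (eta2 g \<xi> i j c x)" for i j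
    using skew_form_wedge[of "Suc 0" "eta g \<xi> i" c x "Suc 0" "eta g \<xi> j"]
    by (simp add: eta2_def numeral_2_eq_2)
  have omega: "skew_form 2 (omega g \<xi> i c x)" for i
  proof (rule skew_form_2)
    show "linear (\<lambda>u. omega g \<xi> i c x [u, v])" for v
      by (auto intro!: linearI simp: omega_eq x linear_add[OF nabla_linear] linear_cmul[OF nabla_linear]
          g_simps algebra_simps)
    show "omega g \<xi> i c x [u, v] = - omega g \<xi> i c x [v, u]" for u v
      unfolding omega_eq[OF x] nabla_skew[OF x, of i u v] by simp
  qed
  have w: "skew_form 4 (wedge 2 (eta2 g \<xi> i j) (omega g \<xi> k) c x)" for i j k
    using skew_form_wedge[of 2 "eta2 g \<xi> i j" c x 2 "omega g \<xi> k", OF eta2 omega] by simp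
  have "alternating_form 4 (\<nu> c x)"
    using \<nu> c x by (simp add: pullback_volume_def differential_form_def)
  then have "skew_form 4 (\<lambda>vs. \<nu> c x vs + - (t\<^sup>2) *
     (\<epsilon> * wedge 2 (eta2 g \<xi> 2 3) (omega g \<xi> 1) c x vs
    + \<epsilon> * wedge 2 (eta2 g \<xi> 3 1) (omega g \<xi> 2) c x vs
    + wedge 2 (eta2 g \<xi> 1 2) (omega g \<xi> 3) c x vs))"
    by (intro skew_form_add skew_form_mult_left w alternating_imp_skew_form)
  then show ?thesis by (simp add: psi_def)
qed

end

context three_sasakian_frame
begin

text \<open>The summand eta_j wedge eta_k cancels the vertical part of d eta_i. What remains is the
  standard self-dual basis e^01 + e^23, e^02 + e^31, e^03 + e^12 in the frame (e, E_1, E_2,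
  E_3).\<close>

lemma omega_table:
  "omega g \<xi> i c x [X j, X k] = 0" "omega g \<xi> i c x [X j, e] = 0" "omega g \<xi> i c x [X j, E k] = 0"
  "omega g \<xi> i c x [e, E i] = 1" "i \<noteq> j \<Longrightarrow> omega g \<xi> i c x [e, E j] = 0"
  "omega g \<xi> 1 c x [E 1, E 2] = 0" "omega g \<xi> 1 c x [E 1, E 3] = 0" "omega g \<xi> 1 c x [E 2, E 3] = 1"
  "omega g \<xi> 2 c x [E 1, E 2] = 0" "omega g \<xi> 2 c x [E 1, E 3] = - 1" "omega g \<xi> 2 c x [E 2, E 3] = 0"
  "omega g \<xi> 3 c x [E 1, E 2] = 1" "omega g \<xi> 3 c x [E 1, E 3] = 0" "omega g \<xi> 3 c x [E 2, E 3] = 0"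
  using exhaust_3[of i] exhaust_3[of j] exhaust_3[of k]
  by (elim disjE; simp add: omega_eq[OF x] N_table g_table g_simps[OF x])+

lemma eta2_eq: "eta2 g \<xi> i j c x [u, v]
    = g c x (X i) u * g c x (X j) v - g c x (X i) v * g c x (X j) u"
  by (simp only: eta2_def One_nat_def wedge_1_pair eta_def nth_Cons_0)

lemma eta2_table:
  "eta2 g \<xi> 2 3 c x [X 1, X 2] = 0" "eta2 g \<xi> 2 3 c x [X 1, X 3] = 0" "eta2 g \<xi> 2 3 c x [X 2, X 3] = 1"
  "eta2 g \<xi> 3 1 c x [X 1, X 2] = 0" "eta2 g \<xi> 3 1 c x [X 1, X 3] = - 1" "eta2 g \<xi> 3 1 c x [X 2, X 3] = 0"
  "eta2 g \<xi> 1 2 c x [X 1, X 2] = 1" "eta2 g \<xi> 1 2 c x [X 1, X 3] = 0" "eta2 g \<xi> 1 2 c x [X 2, X 3] = 0"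
  "eta2 g \<xi> i j c x [X k, e] = 0" "eta2 g \<xi> i j c x [X k, E l] = 0"
  "eta2 g \<xi> i j c x [e, E k] = 0" "eta2 g \<xi> i j c x [E k, E l] = 0"
  unfolding eta2_eq by (simp_all add: g_table)

lemma curvature_table:
  fixes a :: "real^3"
  defines "F \<equiv> ext_deriv (eta_connection g \<xi> a) c x"
  shows "F [X 1, X 2] = - 2 * \<i> * a$3" "F [X 1, X 3] = 2 * \<i> * a$2" "F [X 2, X 3] = - 2 * \<i> * a$1"
    "F [X j, e] = 0" "F [X j, E k] = 0" "F [e, E j] = - 2 * \<i> * a$j"
    "F [E 1, E 2] = - 2 * \<i> * a$3" "F [E 1, E 3] = 2 * \<i> * a$2" "F [E 2, E 3] = - 2 * \<i> * a$1"
  using exhaust_3[of j] exhaust_3[of k] unfolding F_def ext_deriv_eta_connection[OF x] sum_3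
  by (elim disjE; simp add: N_table g_table g_simps[OF x])+

context
  fixes \<nu> assumes \<nu>: "pullback_volume \<A> g \<xi> \<nu>"
begin

lemma volume_vertical:
  "\<nu> c x [X i, p, q, r] = 0" "\<nu> c x [p, X i, q, r] = 0"
  "\<nu> c x [p, q, X i, r] = 0" "\<nu> c x [p, q, r, X i] = 0"
proof -
  show 1: "\<nu> c x [X i, p, q, r] = 0" for p q r
    using \<nu> c x by (simp add: pullback_volume_def)
  have "alternating_form 4 (\<nu> c x)"
    using \<nu> c x by (simp add: pullback_volume_def differential_form_def)
  note swap = skew_form_swap[OF alternating_imp_skew_form[OF this]]
  show 2: "\<nu> c x [p, X i, q, r] = 0" for p q r
    using swap[of "[]" "[q, r]" p "X i"] 1 by simp
  show 3: "\<nu> c x [p, q, X i, r] = 0" for p q r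
    using swap[of "[p]" "[r]" q "X i"] 2 by simp
  show "\<nu> c x [p, q, r, X i] = 0"
    using swap[of "[p, q]" "[]" r "X i"] 3 by simp
qed

lemmas dG2_form_eval = dG2_form_def wedge_2_six wedge_4_six wedge_2_quad psi_def
  omega_table eta2_table curvature_table volume_vertical pullback_volume_frame[OF \<nu>]

text \<open>The three summands of the bracket have separate origins. The cube of the curvature gives
  \<open>4 * n\<close>: a vertical value of F times the horizontal part of F wedge F, which equals
  \<open>- 8 * n\<close>. Pairing the vertical part of F with the volume gives -1, and pairing its
  horizontal part with the eta-eta-omega terms of \<open>psi\<close> gives the
  \<open>t\<^sup>2\<close> term. The middle formula has the opposite sign because (1,3) is in
  anticyclic order.\<close>

lemma dG2_form_omit_vertical:
  fixes a :: "real^3"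
  defines "F \<equiv> ext_deriv (eta_connection g \<xi> a)"
    and "n \<equiv> (a$1)\<^sup>2 + (a$2)\<^sup>2 + (a$3)\<^sup>2"
  shows "dG2_form (psi g \<xi> \<nu> t \<epsilon>) F c x [X 2, X 3, e, E 1, E 2, E 3]
      = \<i> * complex_of_real (2 * a$1 * (4 * n - 1 + 2 * t\<^sup>2 * \<epsilon>))"
    and "dG2_form (psi g \<xi> \<nu> t \<epsilon>) F c x [X 1, X 3, e, E 1, E 2, E 3]
      = - \<i> * complex_of_real (2 * a$2 * (4 * n - 1 + 2 * t\<^sup>2 * \<epsilon>))"
    and "dG2_form (psi g \<xi> \<nu> t \<epsilon>) F c x [X 1, X 2, e, E 1, E 2, E 3]
      = \<i> * complex_of_real (2 * a$3 * (4 * n - 1 + 2 * t\<^sup>2))"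
  unfolding F_def n_def
  by (simp add: dG2_form_eval, simp add: power2_eq_square field_simps)+

text \<open>A parity argument: the curvature and \<open>psi\<close> are nonzero only on tuples with
  an even number of vertical frame vectors, while here there are three.\<close>

lemma dG2_form_omit_horizontal:
  fixes a :: "real^3"
  defines "F \<equiv> ext_deriv (eta_connection g \<xi> a)"
  shows "dG2_form (psi g \<xi> \<nu> t \<epsilon>) F c x [X 1, X 2, X 3, E 1, E 2, E 3] = 0"
    "dG2_form (psi g \<xi> \<nu> t \<epsilon>) F c x [X 1, X 2, X 3, e, E 2, E 3] = 0"
    "dG2_form (psi g \<xi> \<nu> t \<epsilon>) F c x [X 1, X 2, X 3, e, E 1, E 3] = 0"
    "dG2_form (psi g \<xi> \<nu> t \<epsilon>) F c x [X 1, X 2, X 3, e, E 1, E 2] = 0"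
  unfolding F_def by (simp_all add: dG2_form_eval)

end

end

section \<open>From the pointwise form to the instanton equation on the manifold\<close>

lemma unitary_eta_connection:
  assumes ts: "three_sasakian \<A> g \<xi>"
  shows "unitary_connection \<A> (eta_connection g \<xi> a)"
proof -
  let ?A = "eta_connection g \<xi> a"
  have A: "?A c x [v] = \<i> * complex_of_real (\<Sum>i\<in>UNIV. a $ i * g c x (\<xi> i c x) v)" for c x v
    by (simp add: eta_connection_def eta_def)
  have chart: "three_sasakian_chart \<A> g \<xi> c" if "c \<in> \<A>" for c
    using ts that by unfold_locales
  have alt: "alternating_form 1 (?A c x)" if c: "c \<in> \<A>" and x: "x \<in> chart_img c" for c x
  proof -
    interpret three_sasakian_chart \<A> g \<xi> c by (rule chart[OF c])
    have "linear (\<lambda>u. a $ i * g c x (\<xi> i c x) u)" for i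
      using g_linear(1)[OF x, of "\<xi> i c x"] by (simp add: linear_iff distrib_left)
    then have s: "linear (\<lambda>u. \<Sum>i\<in>UNIV. a $ i * g c x (\<xi> i c x) u)"
      by (intro linear_compose_sum ballI)
    have "linear (\<lambda>r. \<i> * complex_of_real r)"
      by (simp add: linear_iff scaleR_conv_of_real distrib_left)
    from linear_compose[OF s this] have "linear (\<lambda>u. ?A c x [u])"
      unfolding A o_def .
    then show ?thesis by (auto simp: alternating_form_def length_Suc_conv)
  qed
  have smooth: "smooth_on (chart_img c) (\<lambda>x. ?A c x [v])" if c: "c \<in> \<A>" for c v
  proof -
    interpret three_sasakian_chart \<A> g \<xi> c by (rule chart[OF c])
    have g\<xi>: "smooth_on S (\<lambda>y. g c y (\<xi> i c y) v)" for i
      by (rule smooth_on_apply_linear[OF open_S g_linear(2) g_smooth \<xi>_smooth])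
    have h: "bounded_linear (\<lambda>r. \<i> * complex_of_real r)"
      by (intro bounded_linear_const_mult bounded_linear_of_real)
    show ?thesis
      unfolding A smooth_on_def
      by (intro allI Ck_on_bounded_linear[OF open_S h] Ck_on_sum[OF open_S] finite
          Ck_on_bounded_linear[OF open_S bounded_linear_mult_right])
        (use g\<xi> in \<open>simp add: smooth_on_def\<close>)
  qed
  have trans: "?A d (transition c d x) [jac c d x v] = ?A c x [v]"
    if "c \<in> \<A>" "d \<in> \<A>" "x \<in> overlap c d" for c d x v
  proof -
    have "vector_field \<A> (\<xi> i)" for i
      using ts by (simp add: three_sasakian_def killing_field_def)
    then have "\<xi> i d (transition c d x) = jac c d x (\<xi> i c x)" for i
      using that by (simp add: vector_field_def)
    moreover have "g d (transition c d x) (jac c d x u) (jac c d x w) = g c x u w" for u w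
      using ts that by (simp add: three_sasakian_def riemannian_metric_def)
    ultimately show ?thesis by (simp add: A)
  qed
  show ?thesis
    unfolding unitary_connection_def differential_form_def
    using alt smooth trans by (auto simp: length_Suc_conv A)
qed

context three_sasakian_frame
begin

text \<open>Six distinct vectors out of seven omit exactly one. Multisets forget the order, which
  does not affect the vanishing of a skew form.\<close>

lemma frame_omit_one:
  assumes bs: "set bs \<subseteq> set frame" "distinct bs" "length bs = 6"
  shows "mset bs \<in> mset ` {[X 2, X 3, e, E 1, E 2, E 3], [X 1, X 3, e, E 1, E 2, E 3],
    [X 1, X 2, e, E 1, E 2, E 3], [X 1, X 2, X 3, E 1, E 2, E 3], [X 1, X 2, X 3, e, E 2, E 3],
    [X 1, X 2, X 3, e, E 1, E 3], [X 1, X 2, X 3, e, E 1, E 2]}" (is "_ \<in> mset ` ?L")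
proof -
  have "card (set frame - set bs) = 1"
    using bs frame_distinct by (simp add: card_Diff_subset distinct_card frame_def)
  then obtain b where b: "set frame - set bs = {b}" by (rule card_1_singletonE)
  then have set: "set bs = set frame - {b}" "b \<in> set frame" using bs(1) by auto
  have "remove1 b frame \<in> ?L"
    using set(2) frame_distinct unfolding frame_def
    by (simp only: list.set insert_iff empty_iff) (elim disjE; simp)
  moreover have "mset bs = mset (remove1 b frame)"
    using bs(2) set(1) frame_distinct
    by (simp add: set_eq_iff_mset_eq_distinct[symmetric] del: mset_remove1)
  ultimately show ?thesis by (rule rev_image_eqI)
qed

lemma dG2_form_eq_0_iff:
  fixes a :: "real^3"
  assumes \<nu>: "pullback_volume \<A> g \<xi> \<nu>"
  defines "n \<equiv> (a$1)\<^sup>2 + (a$2)\<^sup>2 + (a$3)\<^sup>2"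
  shows "(\<forall>vs. length vs = 6 \<longrightarrow>
      dG2_form (psi g \<xi> \<nu> t \<epsilon>) (ext_deriv (eta_connection g \<xi> a)) c x vs = 0) \<longleftrightarrow>
    a$1 * (4 * n - 1 + 2 * t\<^sup>2 * \<epsilon>) = 0 \<and> a$2 * (4 * n - 1 + 2 * t\<^sup>2 * \<epsilon>) = 0 \<and>
    a$3 * (4 * n - 1 + 2 * t\<^sup>2) = 0" (is "(\<forall>vs. _ \<longrightarrow> ?f vs = 0) \<longleftrightarrow> ?R")
proof -
  note v = dG2_form_omit_vertical[OF \<nu>, of t \<epsilon> a, folded n_def]
  have vert: "?f [X 2, X 3, e, E 1, E 2, E 3] = 0 \<longleftrightarrow> a$1 * (4 * n - 1 + 2 * t\<^sup>2 * \<epsilon>) = 0"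
    "?f [X 1, X 3, e, E 1, E 2, E 3] = 0 \<longleftrightarrow> a$2 * (4 * n - 1 + 2 * t\<^sup>2 * \<epsilon>) = 0"
    "?f [X 1, X 2, e, E 1, E 2, E 3] = 0 \<longleftrightarrow> a$3 * (4 * n - 1 + 2 * t\<^sup>2) = 0"
    unfolding v by (simp_all only: mult_eq_0_iff of_real_eq_0_iff neg_equal_0_iff_equal) simp_all
  have skew: "skew_form 6 ?f"
    by (intro skew_form_dG2_form skew_form_curvature skew_form_psi x \<nu>)
  show ?thesis
  proof
    assume "\<forall>vs. length vs = 6 \<longrightarrow> ?f vs = 0"
    \<comment> \<open>Necessity uses only the three tuples that omit a vertical vector; all seven
      enter in the converse.\<close>
    then show ?R unfolding vert[symmetric] by simp
  next
    assume ?R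
    have "?f bs = 0" if bs: "set bs \<subseteq> set frame" "distinct bs" "length bs = 6" for bs
    proof -
      from frame_omit_one[OF bs] obtain l where l: "mset bs = mset l"
        "l \<in> {[X 2, X 3, e, E 1, E 2, E 3], [X 1, X 3, e, E 1, E 2, E 3],
          [X 1, X 2, e, E 1, E 2, E 3], [X 1, X 2, X 3, E 1, E 2, E 3], [X 1, X 2, X 3, e, E 2, E 3],
          [X 1, X 2, X 3, e, E 1, E 3], [X 1, X 2, X 3, e, E 1, E 2]}" by blast
      have "?f l = 0"
        using l(2) \<open>?R\<close>[folded vert] dG2_form_omit_horizontal[OF \<nu>, of t \<epsilon> a] by blast
      moreover have "length l = 6" using l(1) bs(3) by (metis mset_eq_length)
      ultimately show ?thesis
        using skew_form_perm_zero[OF skew l(1)[symmetric], of "[]"] by simp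
    qed
    then show "\<forall>vs. length vs = 6 \<longrightarrow> ?f vs = 0"
      using skew_form_eq_0_if_basis[OF skew frame_span] by blast
  qed
qed

end

lemma deformed_G2_instanton_eta_iff:
  fixes \<A> :: "'a::topological_space chart set" and a :: "real^3"
  assumes ts: "three_sasakian \<A> g \<xi>" and \<nu>: "pullback_volume \<A> g \<xi> \<nu>"
  defines "n \<equiv> (a$1)\<^sup>2 + (a$2)\<^sup>2 + (a$3)\<^sup>2"
  shows "deformed_G2_instanton \<A> (psi g \<xi> \<nu> t \<epsilon>) (eta_connection g \<xi> a) \<longleftrightarrow>
    a$1 * (4 * n - 1 + 2 * t\<^sup>2 * \<epsilon>) = 0 \<and> a$2 * (4 * n - 1 + 2 * t\<^sup>2 * \<epsilon>) = 0 \<and>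
    a$3 * (4 * n - 1 + 2 * t\<^sup>2) = 0" (is "_ \<longleftrightarrow> ?R")
proof -
  have point: "(\<forall>vs. length vs = 6 \<longrightarrow>
      dG2_form (psi g \<xi> \<nu> t \<epsilon>) (ext_deriv (eta_connection g \<xi> a)) c x vs = 0) \<longleftrightarrow> ?R"
    if c: "c \<in> \<A>" and x: "x \<in> chart_img c" for c x
  proof -
    interpret three_sasakian_chart \<A> g \<xi> c using ts c by unfold_locales
    obtain e where "g c x e e = 1" "\<And>i. g c x (\<xi> i c x) e = 0"
      using unit_horizontal_exists[OF x] by blast
    then interpret three_sasakian_frame \<A> g \<xi> c x e using x by unfold_locales
    show ?thesis unfolding n_def by (rule dG2_form_eq_0_iff[OF \<nu>])
  qed
  \<comment> \<open>The pointwise criterion is the same at every point, but at least one point must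
    exist for necessity; the charts cover a type, which is never empty.\<close>
  have "(\<Union>c\<in>\<A>. fst c) = UNIV" using ts by (simp add: three_sasakian_def smooth_atlas_def)
  then obtain c where "c \<in> \<A>" "fst c \<noteq> {}" by blast
  then obtain x where "c \<in> \<A>" "x \<in> chart_img c" by (auto simp: chart_img_def)
  then have "(\<forall>c\<in>\<A>. \<forall>x\<in>chart_img c. \<forall>vs. length vs = 6 \<longrightarrow>
      dG2_form (psi g \<xi> \<nu> t \<epsilon>) (ext_deriv (eta_connection g \<xi> a)) c x vs = 0) \<longleftrightarrow> ?R"
    using point by blast
  then show ?thesis
    using unitary_eta_connection[OF ts, of a]
    by (simp only: deformed_G2_instanton_def Let_def dG2_form_def simp_thms)
qed

section \<open>Solving the three scalar equations\<close>

lemma less_inverse_sqrt_2_iff: "t > 0 \<Longrightarrow> t < 1 / sqrt 2 \<longleftrightarrow> 2 * t\<^sup>2 < 1" for t :: real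
proof -
  assume "t > 0"
  then have "t < 1 / sqrt 2 \<longleftrightarrow> \<bar>t * sqrt 2\<bar> < 1" by (simp add: field_simps)
  then show ?thesis by (simp add: abs_square_less_1[symmetric] power_mult_distrib mult.commute)
qed

lemma mem_sphere_0_vec3:
  "r \<ge> 0 \<Longrightarrow> (b::real^3) \<in> sphere 0 (sqrt r) \<longleftrightarrow> (b$1)\<^sup>2 + (b$2)\<^sup>2 + (b$3)\<^sup>2 = r"
  by (simp add: norm_vec_def L2_set_def sum_3)

theorem proposition4p4:
  fixes \<A> :: "'a::{t2_space, second_countable_topology} chart set"
    and g :: "'a metric" and \<xi> :: "3 \<Rightarrow> 'a vfield" and \<nu> :: "('a, real) form"
    and t \<epsilon> :: real and a :: "real^3"
  assumes "three_sasakian \<A> g \<xi>"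
    and "pullback_volume \<A> g \<xi> \<nu>"
    and "t > 0" and "\<epsilon> \<in> {1, -1}"
  defines "nontrivial_solutions \<equiv>
    {b :: real^3. b \<noteq> 0 \<and> deformed_G2_instanton \<A> (psi g \<xi> \<nu> t \<epsilon>) (eta_connection g \<xi> b)}"
  shows "(deformed_G2_instanton \<A> (psi g \<xi> \<nu> t \<epsilon>) (eta_connection g \<xi> a) \<longleftrightarrow>
      (a$1 = 0 \<and> a$2 = 0 \<and> a$3 = 0)
    \<or> (t < 1 / sqrt 2 \<and> \<epsilon> = 1 \<and> (a$1)\<^sup>2 + (a$2)\<^sup>2 + (a$3)\<^sup>2 = 1/4 * (1 - 2 * t\<^sup>2))
    \<or> (t < 1 / sqrt 2 \<and> \<epsilon> = -1 \<and>
        (((a$1)\<^sup>2 + (a$2)\<^sup>2 = 1/4 * (1 + 2 * t\<^sup>2) \<and> a$3 = 0)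
         \<or> ((a$1)\<^sup>2 + (a$2)\<^sup>2 = 0 \<and> (a$3)\<^sup>2 = 1/4 * (1 - 2 * t\<^sup>2))))
    \<or> (t \<ge> 1 / sqrt 2 \<and> \<epsilon> = -1 \<and> (a$1)\<^sup>2 + (a$2)\<^sup>2 = 1/4 * (1 + 2 * t\<^sup>2) \<and> a$3 = 0))
    \<and> (t < 1 / sqrt 2 \<and> \<epsilon> = 1 \<longrightarrow> (\<exists>r>0. nontrivial_solutions = sphere 0 r))
    \<and> (t < 1 / sqrt 2 \<and> \<epsilon> = -1 \<longrightarrow> (\<exists>r>0. \<exists>s>0. nontrivial_solutions =
         {b \<in> sphere 0 r. b$3 = 0} \<union> {axis 3 s, axis 3 (- s)}))
    \<and> (t \<ge> 1 / sqrt 2 \<and> \<epsilon> = -1 \<longrightarrow> (\<exists>r>0. nontrivial_solutions = {b \<in> sphere 0 r. b$3 = 0}))"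
proof -
  let ?D = "\<lambda>b. deformed_G2_instanton \<A> (psi g \<xi> \<nu> t \<epsilon>) (eta_connection g \<xi> b)"
  let ?n = "\<lambda>b::real^3. (b$1)\<^sup>2 + (b$2)\<^sup>2 + (b$3)\<^sup>2"
  note D = deformed_G2_instanton_eta_iff[OF assms(1,2), of t \<epsilon>]
  note lt = less_inverse_sqrt_2_iff[OF assms(3)]
  have ge: "t \<ge> 1 / sqrt 2 \<longleftrightarrow> \<not> 2 * t\<^sup>2 < 1" using lt by linarith
  have b0: "b = 0 \<longleftrightarrow> b$1 = 0 \<and> b$2 = 0 \<and> b$3 = 0" for b :: "real^3"
    by (simp add: vec_eq_iff forall_3)
  have n0: "?n b = 0 \<longleftrightarrow> b$1 = 0 \<and> b$2 = 0 \<and> b$3 = 0" for b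
    by (simp add: add_nonneg_eq_0_iff)
  have n_ge: "?n b \<ge> 0" for b by simp
  have n12: "(b$1)\<^sup>2 + (b$2)\<^sup>2 = 0 \<longleftrightarrow> b$1 = 0 \<and> b$2 = 0" for b :: "real^3"
    by (rule sum_power2_eq_zero_iff)
  have t2: "t\<^sup>2 > 0" using assms(3) by simp
  have plus: "?D b \<longleftrightarrow> b = 0 \<or> ?n b = 1/4 * (1 - 2 * t\<^sup>2)" if "\<epsilon> = 1" for b
    unfolding D b0 using that by auto
  have minus: "?D b \<longleftrightarrow> b = 0 \<or> ((b$1)\<^sup>2 + (b$2)\<^sup>2 = 1/4 * (1 + 2 * t\<^sup>2) \<and> b$3 = 0)
      \<or> (b$1 = 0 \<and> b$2 = 0 \<and> (b$3)\<^sup>2 = 1/4 * (1 - 2 * t\<^sup>2))" if "\<epsilon> = -1" for b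
  proof -
    have "?D b \<longleftrightarrow> (b$1 = 0 \<and> b$2 = 0 \<or> 4 * ?n b = 1 + 2 * t\<^sup>2) \<and> (b$3 = 0 \<or> 4 * ?n b = 1 - 2 * t\<^sup>2)"
      unfolding D using that by auto
    also have "\<dots> \<longleftrightarrow> b = 0 \<or> ((b$1)\<^sup>2 + (b$2)\<^sup>2 = 1/4 * (1 + 2 * t\<^sup>2) \<and> b$3 = 0)
      \<or> (b$1 = 0 \<and> b$2 = 0 \<and> (b$3)\<^sup>2 = 1/4 * (1 - 2 * t\<^sup>2))"
      \<comment> \<open>If b_3 and one of b_1, b_2 were nonzero, \<open>4 * ?n b\<close> would equal
        both \<open>1 + 2 * t\<^sup>2\<close> and \<open>1 - 2 * t\<^sup>2\<close>, impossible for
        positive t.\<close>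
      unfolding b0 using t2 by auto
    finally show ?thesis .
  qed
  have pos: "b \<noteq> 0" if "?n b > 0" for b using that by auto
  have "?D a \<longleftrightarrow>
      (a$1 = 0 \<and> a$2 = 0 \<and> a$3 = 0)
    \<or> (t < 1 / sqrt 2 \<and> \<epsilon> = 1 \<and> ?n a = 1/4 * (1 - 2 * t\<^sup>2))
    \<or> (t < 1 / sqrt 2 \<and> \<epsilon> = -1 \<and>
        (((a$1)\<^sup>2 + (a$2)\<^sup>2 = 1/4 * (1 + 2 * t\<^sup>2) \<and> a$3 = 0)
         \<or> ((a$1)\<^sup>2 + (a$2)\<^sup>2 = 0 \<and> (a$3)\<^sup>2 = 1/4 * (1 - 2 * t\<^sup>2))))
    \<or> (t \<ge> 1 / sqrt 2 \<and> \<epsilon> = -1 \<and> (a$1)\<^sup>2 + (a$2)\<^sup>2 = 1/4 * (1 + 2 * t\<^sup>2) \<and> a$3 = 0)"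
  proof (cases "2 * t\<^sup>2 < 1")
    case True
    then show ?thesis using plus[of a] minus[of a] assms(4) unfolding lt ge n12 b0 by auto
  next
    case False
    \<comment> \<open>The prescribed squared radius is now at most 0, so this family collapses into
      the trivial connection; at \<open>2 * t\<^sup>2 = 1\<close> it is exactly the origin.\<close>
    have "a = 0" if "?n a = 1/4 * (1 - 2 * t\<^sup>2)"
    proof -
      have "?n a \<le> 0" unfolding that using False by simp
      then have "?n a = 0" using n_ge[of a] by (rule antisym)
      then show ?thesis using n0 b0 by blast
    qed
    moreover have "a$3 = 0" if "(a$3)\<^sup>2 = 1/4 * (1 - 2 * t\<^sup>2)"
    proof -
      have "(a$3)\<^sup>2 \<le> 0" unfolding that using False by simp
      then show ?thesis by simp
    qed
    ultimately show ?thesis using False plus[of a] minus[of a] assms(4) unfolding lt ge n12 b0 by auto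
  qed
  moreover have "\<exists>r>0. nontrivial_solutions = sphere 0 r" if "t < 1 / sqrt 2 \<and> \<epsilon> = 1"
  proof (intro exI conjI)
    have r: "1/4 * (1 - 2 * t\<^sup>2) > 0" using that lt by simp
    then show "sqrt (1/4 * (1 - 2 * t\<^sup>2)) > 0" by simp
    show "nontrivial_solutions = sphere 0 (sqrt (1/4 * (1 - 2 * t\<^sup>2)))"
      using plus that r pos
      unfolding nontrivial_solutions_def set_eq_iff mem_Collect_eq mem_sphere_0_vec3[OF less_imp_le[OF r]]
      by metis
  qed
  moreover have "\<exists>r>0. \<exists>s>0. nontrivial_solutions = {b \<in> sphere 0 r. b$3 = 0} \<union> {axis 3 s, axis 3 (- s)}"
    if "t < 1 / sqrt 2 \<and> \<epsilon> = -1"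
  proof (intro exI conjI)
    let ?s = "sqrt (1/4 * (1 - 2 * t\<^sup>2))"
    have s: "1/4 * (1 - 2 * t\<^sup>2) > 0" using that lt by simp
    have r: "1/4 * (1 + 2 * t\<^sup>2) > 0" by (simp add: add_pos_nonneg)
    then show "sqrt (1/4 * (1 + 2 * t\<^sup>2)) > 0" by simp
    from s show s0: "?s > 0" by simp
    have ax: "b = axis 3 u \<longleftrightarrow> b$1 = 0 \<and> b$2 = 0 \<and> b$3 = u" for b :: "real^3" and u
      by (simp add: vec_eq_iff forall_3 axis_def)
    have sq: "u\<^sup>2 = 1/4 * (1 - 2 * t\<^sup>2) \<longleftrightarrow> u = ?s \<or> u = - ?s" for u
      using power2_eq_iff[of u ?s] unfolding real_sqrt_pow2[OF less_imp_le[OF s]] .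
    show "nontrivial_solutions = {b \<in> sphere 0 (sqrt (1/4 * (1 + 2 * t\<^sup>2))). b$3 = 0} \<union> {axis 3 ?s, axis 3 (- ?s)}"
    proof (intro set_eqI)
      fix b :: "real^3"
      have "b \<in> nontrivial_solutions \<longleftrightarrow> b \<noteq> 0 \<and> (((b$1)\<^sup>2 + (b$2)\<^sup>2 = 1/4 * (1 + 2 * t\<^sup>2) \<and> b$3 = 0)
        \<or> (b$1 = 0 \<and> b$2 = 0 \<and> (b$3 = ?s \<or> b$3 = - ?s)))"
        unfolding nontrivial_solutions_def sq[symmetric] using minus[of b] that by blast
      also have "\<dots> \<longleftrightarrow> (?n b = 1/4 * (1 + 2 * t\<^sup>2) \<and> b$3 = 0) \<or> b = axis 3 ?s \<or> b = axis 3 (- ?s)"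
        \<comment> \<open>Both radii are positive, so no point of the circle or of the pair is the
          excluded origin.\<close>
        unfolding ax b0 using r s0 by auto
      finally show "b \<in> nontrivial_solutions \<longleftrightarrow>
          b \<in> {b \<in> sphere 0 (sqrt (1/4 * (1 + 2 * t\<^sup>2))). b$3 = 0} \<union> {axis 3 ?s, axis 3 (- ?s)}"
        using mem_sphere_0_vec3[OF less_imp_le[OF r]] by blast
    qed
  qed
  moreover have "\<exists>r>0. nontrivial_solutions = {b \<in> sphere 0 r. b$3 = 0}"
    if "t \<ge> 1 / sqrt 2 \<and> \<epsilon> = -1"
  proof (intro exI conjI)
    have r: "1/4 * (1 + 2 * t\<^sup>2) > 0" by (simp add: add_pos_nonneg)
    then show "sqrt (1/4 * (1 + 2 * t\<^sup>2)) > 0" by simp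
    show "nontrivial_solutions = {b \<in> sphere 0 (sqrt (1/4 * (1 + 2 * t\<^sup>2))). b$3 = 0}"
    proof (intro set_eqI)
      fix b :: "real^3"
      \<comment> \<open>The two points on the third axis are lost here: their squared height would
        be at most 0.\<close>
      have z: "b$3 = 0" if "(b$3)\<^sup>2 = 1/4 * (1 - 2 * t\<^sup>2)"
      proof -
        have "(b$3)\<^sup>2 \<le> 0" unfolding that using \<open>t \<ge> 1 / sqrt 2 \<and> \<epsilon> = -1\<close> ge by simp
        then show ?thesis by simp
      qed
      have "b \<in> nontrivial_solutions \<longleftrightarrow> b \<noteq> 0 \<and> (b$1)\<^sup>2 + (b$2)\<^sup>2 = 1/4 * (1 + 2 * t\<^sup>2) \<and> b$3 = 0"
        unfolding nontrivial_solutions_def using minus[of b] that z b0 by blast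
      also have "\<dots> \<longleftrightarrow> ?n b = 1/4 * (1 + 2 * t\<^sup>2) \<and> b$3 = 0"
        unfolding b0 using r by auto
      finally show "b \<in> nontrivial_solutions \<longleftrightarrow> b \<in> {b \<in> sphere 0 (sqrt (1/4 * (1 + 2 * t\<^sup>2))). b$3 = 0}"
        using mem_sphere_0_vec3[OF less_imp_le[OF r]] by blast
    qed
  qed
  ultimately show ?thesis by blast
qed

end
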